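(* The bifurcation equation $F(\varepsilon,c)=0$ admits one and only one solution $c(\varepsilon)$. One has $c(\varepsilon)=c_{0}+\zeta_{1}\varepsilon+O(\varepsilon^{2})$ for some constant $\zeta_{1}\neq 0$ if $[(X^{(1)}(\cdot))^{\mathfrak{n}}]_{0}\neq 0$, and $c(\varepsilon)=c_{0}+O(\varepsilon^{2})$ if $[(X^{(1)}(\cdot))^{\mathfrak{n}}]_{0}=0$.
   Context: Setting. $g:\mathbb{R}\to\mathbb{R}$ and $f:\mathbb{T}^{d}\to\mathbb{R}$ ($\mathbb{T}=\mathbb{R}/2\pi\mathbb{Z}$) are real analytic, $f(\psi)=\sum_{\nu\in\mathbb{Z}^{d}}e^{i\nu\cdot\psi}f_{\nu}$, and $\varepsilon$ is a small real parameter. The vector $\omega\in\mathbb{R}^{d}$ satisfies the Bryuno condition $\sum_{n\ge0}2^{-n}\log(1/\alpha_{n}(\omega))<\infty$, where $\alpha_{n}(\omega)=\inf\{|\omega\cdot\nu|:\nu\in\mathbb{Z}^{d},\,0<|\nu|\le 2^{n}\}$. The point $c_{0}\in\mathbb{R}$ is a zero of odd order $\mathfrak{n}$ of $g(x)-f_{0}=0$, i.e. $g(c_0)=f_0$, $g_{0}=\frac{1}{\mathfrak{n}!}\frac{\mathrm{d}^{\mathfrak{n}}g}{\mathrm{d}x^{\mathfrak{n}}}(c_{0})\ne0$ and, if $\mathfrak{n}>1$, $\frac{\mathrm{d}^{k}g}{\mathrm{d}x^{k}}(c_{0})=0$ for $1\le k\le\mathfrak{n}-1$. For a function $h$ on $\mathbb{T}^{d}$,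 $[h]_{\nu}$ (or $[h(\cdot)]_\nu$) denotes its Fourier coefficient of index $\nu$; $[h]_{0}$ is its average. The function $X$. It is known that for all $(\varepsilon,c)$ in a neighbourhood of $(0,c_{0})$ there is a real-valued function $X(\psi;\varepsilon,c)=\sum_{\nu\in\mathbb{Z}^{d}\setminus\{0\}}e^{i\nu\cdot\psi}X_{\nu}(\varepsilon,c)$ on $\mathbb{T}^{d}$ (zero average) solving the range equation $$i\,\omega\cdot\nu\,(1+i\varepsilon\,\omega\cdot\nu)X_{\nu}+\varepsilon\,[g(c+X(\cdot;\varepsilon,c))]_{\nu}=\varepsilon f_{\nu},\qquad \nu\ne0,$$ such that the map $(\varepsilon,c)\mapsto X(\cdot;\varepsilon,c)$ (into continuous functions on $\mathbb{T}^d$ with the sup norm) is $C^{\infty}$ near $(0,c_{0})$ and $X(\psi;\varepsilon,c)=\varepsilon X^{(1)}(\psi)+o(\varepsilon)$, where $X^{(1)}$ is the zero-average function on $\mathbb{T}^{d}$ with $\frac{\mathrm{d}}{\mathrm{d}t}X^{(1)}(\omega t)=f(\omega t)-f_{0}$, i.e. $X^{(1)}_{\nu}=f_{\nu}/(i\omega\cdot\nu)$ for $\nu\neq0$. Such a family $X$ is fixed. The bifurcation equation is $F(\varepsilon,c)=0$, where $F(\varepsilon,c):=[g(c+X(\cdot;\varepsilon,c))]_{0}-f_{0}$; $F$ is $C^{\infty}$ near $(0,c_{0})$. A solution of the bifurcation equation means a function $c(\varepsilon)=c_{0}+\zeta(\varepsilon)$, defined for $\varepsilon$ small enough, with $\zeta(0)=0$,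 $\zeta(\varepsilon)\to0$ as $\varepsilon\to0$, and $F(\varepsilon,c(\varepsilon))=0$; solutions that agree for all $\varepsilon$ small enough are identified. *)

theory Defs
  imports "HOL-Analysis.Analysis" "HOL-Library.Landau_Symbols"
begin

(* Functions on the torus T^d = (R/2 pi Z)^d are represented by functions on R^d that are
   2 pi-periodic in each variable.  For continuous periodic functions the sup norm over T^d is
   the norm of the library type of bounded continuous functions on R^d. *)

definition torus_periodic :: "(real ^ 'd \<Rightarrow> 'a) \<Rightarrow> bool" where
  "torus_periodic h \<longleftrightarrow> (\<forall>\<psi> i. h (\<psi> + axis i (2 * pi)) = h \<psi>)"

definition torus_avg :: "(real ^ 'd \<Rightarrow> 'a::real_normed_vector) \<Rightarrow> 'a" where
  "torus_avg h = (1 / (2 * pi) ^ CARD('d)) *\<^sub>R integral (cbox 0 (\<chi> i. 2 * pi)) h"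

definition real_vec :: "int ^ 'd \<Rightarrow> real ^ 'd" where
  "real_vec \<nu> = (\<chi> i. real_of_int (\<nu> $ i))"

(* The Fourier coefficient [h]_nu of a real function h on the torus.  Its value at index 0
   is written as the real number torus_avg h; see fourier_coeff_0. *)
definition fourier_coeff :: "(real ^ 'd \<Rightarrow> real) \<Rightarrow> int ^ 'd \<Rightarrow> complex" where
  "fourier_coeff h \<nu> = torus_avg (\<lambda>\<psi>. cis (- (real_vec \<nu> \<bullet> \<psi>)) * complex_of_real (h \<psi>))"

lemma fourier_coeff_0:
  fixes h :: "real ^ 'd \<Rightarrow> real"
  assumes "continuous_on UNIV h"
  shows "fourier_coeff h 0 = complex_of_real (torus_avg h)"
proof -
  have "h integrable_on cbox 0 (\<chi> i. 2 * pi)"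
    using assms by (intro integrable_continuous continuous_on_subset[OF assms]) auto
  from integral_linear[OF this bounded_linear_of_real[where 'a = complex]]
  have "integral (cbox 0 (\<chi> i. 2 * pi)) (\<lambda>\<psi>. complex_of_real (h \<psi>))
      = complex_of_real (integral (cbox 0 (\<chi> i. 2 * pi)) h)"
    by (simp add: o_def)
  moreover have "real_vec 0 = (0 :: real ^ 'd)"
    by (simp add: real_vec_def vec_eq_iff)
  ultimately show ?thesis
    by (simp add: fourier_coeff_def torus_avg_def scaleR_conv_of_real)
qed

definition l1_norm :: "int ^ 'd \<Rightarrow> int" where
  "l1_norm \<nu> = (\<Sum>i\<in>UNIV. \<bar>\<nu> $ i\<bar>)"

definition bryuno_alpha :: "real ^ 'd \<Rightarrow> nat \<Rightarrow> real" where
  "bryuno_alpha \<omega> n =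
     Inf {\<bar>\<omega> \<bullet> real_vec \<nu>\<bar> | \<nu>. 0 < l1_norm \<nu> \<and> l1_norm \<nu> \<le> 2 ^ n}"

(* Positivity of the alpha_n is implicit in the finiteness of the sum of 2^(-n) log (1/alpha_n);
   it has to be explicit here because ln (1/0) = 0 in HOL.  As alpha_n is non-increasing, the
   terms eventually have constant sign, so that finiteness of the sum is summability. *)
definition bryuno :: "real ^ 'd \<Rightarrow> bool" where
  "bryuno \<omega> \<longleftrightarrow>
     (\<forall>n. bryuno_alpha \<omega> n > 0) \<and> summable (\<lambda>n. (1 / 2 ^ n) * ln (1 / bryuno_alpha \<omega> n))"

definition real_analytic :: "(real \<Rightarrow> real) \<Rightarrow> bool" where
  "real_analytic g \<longleftrightarrow>
     (\<forall>x. \<exists>r>0. \<exists>a :: nat \<Rightarrow> real. \<forall>y. \<bar>y - x\<bar> < r \<longrightarrow> (\<lambda>k. a k * (y - x) ^ k) sums g y)"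

(* The multivariate power series is indexed by multi-indices m :: 'd => nat and converges
   unconditionally on a polydisc. *)
definition real_analytic_vec :: "(real ^ 'd \<Rightarrow> real) \<Rightarrow> bool" where
  "real_analytic_vec f \<longleftrightarrow>
     (\<forall>x. \<exists>r>0. \<exists>a :: ('d \<Rightarrow> nat) \<Rightarrow> real. \<forall>y. (\<forall>i. \<bar>y $ i - x $ i\<bar> < r) \<longrightarrow>
        ((\<lambda>m. a m * (\<Prod>i\<in>UNIV. (y $ i - x $ i) ^ m i)) has_sum f y) UNIV)"

(* C^k on an open subset of a Euclidean space, with values in a normed space: all iterated
   directional derivatives up to order k exist (as Frechet derivatives) and are continuous. *)
primrec C_k_on ::
  "nat \<Rightarrow> 'a::euclidean_space set \<Rightarrow> ('a \<Rightarrow> 'b::real_normed_vector) \<Rightarrow> bool" where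
  "C_k_on 0 S h \<longleftrightarrow> continuous_on S h"
| "C_k_on (Suc k) S h \<longleftrightarrow>
     (\<forall>x\<in>S. h differentiable (at x)) \<and> (\<forall>v. C_k_on k S (\<lambda>x. frechet_derivative h (at x) v))"

definition C_infinity_on ::
  "'a::euclidean_space set \<Rightarrow> ('a \<Rightarrow> 'b::real_normed_vector) \<Rightarrow> bool" where
  "C_infinity_on S h \<longleftrightarrow> (\<forall>k. C_k_on k S h)"

(* x is a zero of order n >= 1 of the function g - a. *)
definition zero_of_order :: "(real \<Rightarrow> real) \<Rightarrow> real \<Rightarrow> real \<Rightarrow> nat \<Rightarrow> bool" where
  "zero_of_order g a x n \<longleftrightarrow>
     g x = a \<and> (\<forall>k. 1 \<le> k \<and> k \<le> n - 1 \<longrightarrow> (deriv ^^ k) g x = 0) \<and>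
     (deriv ^^ n) g x / fact n \<noteq> 0"

definition zero_avg_series :: "((real ^ 'd) \<Rightarrow>\<^sub>C real) \<Rightarrow> bool" where
  "zero_avg_series h \<longleftrightarrow> torus_periodic (apply_bcontfun h) \<and> torus_avg (apply_bcontfun h) = 0 \<and>
     (\<forall>\<psi>. ((\<lambda>\<nu>. cis (real_vec \<nu> \<bullet> \<psi>) * fourier_coeff (apply_bcontfun h) \<nu>)
            has_sum complex_of_real (apply_bcontfun h \<psi>)) (- {0}))"

definition range_equation ::
  "(real \<Rightarrow> real) \<Rightarrow> (real ^ 'd \<Rightarrow> real) \<Rightarrow> real ^ 'd \<Rightarrow> real \<Rightarrow> real \<Rightarrow> (real ^ 'd \<Rightarrow> real) \<Rightarrow> bool" where
  "range_equation g f \<omega> \<epsilon> c h \<longleftrightarrow>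
     (\<forall>\<nu>. \<nu> \<noteq> 0 \<longrightarrow>
        \<i> * complex_of_real (\<omega> \<bullet> real_vec \<nu>)
          * (1 + \<i> * complex_of_real \<epsilon> * complex_of_real (\<omega> \<bullet> real_vec \<nu>)) * fourier_coeff h \<nu>
        + complex_of_real \<epsilon> * fourier_coeff (\<lambda>\<psi>. g (c + h \<psi>)) \<nu>
        = complex_of_real \<epsilon> * fourier_coeff f \<nu>)"

definition first_order_term ::
  "(real ^ 'd \<Rightarrow> real) \<Rightarrow> real ^ 'd \<Rightarrow> (real ^ 'd \<Rightarrow> real) \<Rightarrow> bool" where
  "first_order_term f \<omega> h \<longleftrightarrow> torus_periodic h \<and> torus_avg h = 0 \<and>
     (\<forall>t. ((\<lambda>s. h (s *\<^sub>R \<omega>)) has_real_derivative f (t *\<^sub>R \<omega>) - torus_avg f) (at t)) \<and>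
     (\<forall>\<nu>. \<nu> \<noteq> 0 \<longrightarrow>
        fourier_coeff h \<nu> = fourier_coeff f \<nu> / (\<i> * complex_of_real (\<omega> \<bullet> real_vec \<nu>)))"

definition bif_fun ::
  "(real \<Rightarrow> real) \<Rightarrow> (real ^ 'd \<Rightarrow> real) \<Rightarrow> (real \<Rightarrow> real \<Rightarrow> (real ^ 'd) \<Rightarrow>\<^sub>C real)
     \<Rightarrow> real \<Rightarrow> real \<Rightarrow> real" where
  "bif_fun g f X \<epsilon> c = torus_avg (\<lambda>\<psi>. g (c + apply_bcontfun (X \<epsilon> c) \<psi>)) - torus_avg f"

(* Solutions are total functions of which only the germ at 0 matters. *)
definition bif_solution :: "(real \<Rightarrow> real \<Rightarrow> real) \<Rightarrow> real \<Rightarrow> (real \<Rightarrow> real) \<Rightarrow> bool" where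
  "bif_solution F c0 c \<longleftrightarrow>
     c 0 = c0 \<and> (c \<longlongrightarrow> c0) (at 0) \<and> (\<forall>\<^sub>F \<epsilon> in nhds 0. F \<epsilon> (c \<epsilon>) = 0)"

end

theory Submission
  imports Defs
begin

text \<open>
  Up to the sign of its leading coefficient, \<open>g\<close> is strictly increasing near \<open>c\<^sub>0\<close>, because the order
  \<open>n\<close> is odd.  As \<open>X\<close> vanishes for \<open>\<epsilon> = 0\<close>, its derivative in \<open>c\<close> is small near \<open>(0, c\<^sub>0)\<close>, so that
  \<open>c + X(\<psi>; \<epsilon>, c)\<close> and hence \<open>F(\<epsilon>, c)\<close> are strictly increasing in \<open>c\<close>; this gives uniqueness.
  For existence, let \<open>\<zeta>\<close> be the unique zero of the strictly increasing function
  \<open>z \<mapsto> [(z + X1)^n]\<^sub>0\<close>; it vanishes iff \<open>[X1^n]\<^sub>0\<close> does.  Since \<open>X = \<epsilon> X1 + O(\<epsilon>\<^sup>2)\<close>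
  uniformly in \<open>c\<close>, the function \<open>F(\<epsilon>, \<cdot>)\<close> takes opposite signs at
  \<open>c\<^sub>0 + \<zeta> \<epsilon> \<plusminus> K \<epsilon>\<^sup>2\<close> for \<open>K\<close> large, and the zero in between is the solution.
\<close>

text \<open>With \<open>u = a + b\<close> and the even exponent \<open>m = n - 1\<close>, twice
  \<open>u^n - a^n\<close> equals \<open>(u + a) * (u^m - a^m) + (u - a) * (u^m + a^m)\<close>. As
  \<open>a \<le> u\<close>, the two factors of the first product never have opposite signs, and the
  second product is at least \<open>b * a^m\<close>. This quantifies how much a positive increment
  raises an odd power, whatever the sign of \<open>a\<close>.\<close>

lemma odd_power_diff_ge:
  fixes a b :: real
  assumes "odd n" "0 \<le> b"
  shows "a ^ n + b / 2 * a ^ (n - 1) \<le> (a + b) ^ n"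
proof -
  obtain m where m: "n = Suc m" "even m"
    using \<open>odd n\<close> by (cases n) auto
  define u where "u = a + b"
  have "0 \<le> (u + a) * (u ^ m - a ^ m)"
  proof (cases "0 \<le> u + a")
    case True
    then have "\<bar>a\<bar> \<le> \<bar>u\<bar>"
      using \<open>0 \<le> b\<close> by (auto simp: u_def)
    then have "a ^ m \<le> u ^ m"
      using power_mono_even[OF m(2)] by blast
    with True show ?thesis by simp
  next
    case False
    then have "\<bar>u\<bar> \<le> \<bar>a\<bar>"
      using \<open>0 \<le> b\<close> by (auto simp: u_def)
    then have "u ^ m \<le> a ^ m"
      using power_mono_even[OF m(2)] by blast
    with False show ?thesis by (intro mult_nonpos_nonpos) auto
  qed
  moreover have "(u + a) * (u ^ m - a ^ m) + (u - a) * (u ^ m + a ^ m) = 2 * (u ^ n - a ^ n)"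
    by (simp add: m(1) algebra_simps)
  moreover have "(u - a) * a ^ m \<le> (u - a) * (u ^ m + a ^ m)"
    using \<open>0 \<le> b\<close> m(2) by (intro mult_left_mono) (auto simp: u_def zero_le_even_power)
  ultimately have "(u - a) * a ^ m \<le> 2 * (u ^ n - a ^ n)"
    by linarith
  then show ?thesis
    by (simp add: u_def m(1))
qed

lemma odd_power_strict_mono:
  fixes a b :: real
  assumes "odd n" "a < b"
  shows "a ^ n < b ^ n"
proof -
  have "a ^ n \<le> b ^ n"
    using assms by (intro power_mono_odd) auto
  moreover have "a ^ n \<noteq> b ^ n"
    using assms by (metis less_irrefl odd_real_root_power_cancel)
  ultimately show ?thesis by simp
qed

section \<open>Zeros of odd order\<close>

text \<open>The local series is repackaged as a formal power series, so that the calculus of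
  \<open>eval_fps\<close> and \<open>fps_deriv\<close> applies. Convergence at every positive
  \<open>r' < r\<close> yields the bound on the radius.\<close>

lemma real_analytic_fps:
  assumes "real_analytic g"
  obtains r A where "r > 0" "ereal r \<le> fps_conv_radius A"
    "\<And>y. \<bar>y\<bar> < r \<Longrightarrow> g (x + y) = eval_fps A y"
proof -
  obtain r a where r: "r > 0" "\<And>y. \<bar>y - x\<bar> < r \<Longrightarrow> (\<lambda>k. a k * (y - x) ^ k) sums g y"
    using assms unfolding real_analytic_def by blast
  have sums: "(\<lambda>k. a k * y ^ k) sums g (x + y)" if "\<bar>y\<bar> < r" for y
    using r(2)[of "x + y"] that by simp
  show ?thesis
  proof
    show "ereal r \<le> fps_conv_radius (Abs_fps a)"
      unfolding fps_conv_radius_def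
    proof (rule conv_radius_geI_ex)
      fix r' :: real
      assume "0 < r'" "ereal r' < ereal r"
      then show "\<exists>z. norm z = r' \<and> summable (\<lambda>n. fps_nth (Abs_fps a) n * z ^ n)"
        using sums_summable[OF sums[of r']] by (intro exI[of _ r']) auto
    qed
    show "g (x + y) = eval_fps (Abs_fps a) y" if "\<bar>y\<bar> < r" for y
      using sums_unique[OF sums[OF that]] by (simp add: eval_fps_def)
  qed (fact r(1))
qed

lemma ereal_less_fps_conv_radius:
  assumes "ereal r \<le> fps_conv_radius A" "\<bar>y\<bar> < r"
  shows "ereal (norm (y::real)) < fps_conv_radius A"
  using assms by (metis less_ereal.simps(1) real_norm_def order_less_le_trans)

lemma isCont_real_analytic:
  assumes "real_analytic g"
  shows "isCont g x"
proof -
  obtain r A where A: "r > 0" "ereal r \<le> fps_conv_radius A"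
    "\<And>y. \<bar>y\<bar> < r \<Longrightarrow> g (x + y) = eval_fps A y"
    using real_analytic_fps[OF assms, of x] by blast
  have "isCont (eval_fps A) 0"
    using A(1,2) by (intro DERIV_isCont[OF has_field_derivative_eval_fps] 
      ereal_less_fps_conv_radius[OF A(2)]) auto
  moreover have "\<forall>\<^sub>F y in at 0. eval_fps A y = g (x + y)"
    unfolding eventually_at using A(1,3) by (intro exI[of _ r]) (simp add: dist_real_def)
  ultimately have "((\<lambda>y. g (x + y)) \<longlongrightarrow> eval_fps A 0) (at 0)"
    unfolding isCont_def by (rule Lim_transform_eventually)
  moreover have "eval_fps A 0 = g x"
    using A(1) A(3)[of 0] by simp
  ultimately show ?thesis
    by (simp add: isCont_iff)
qed

text \<open>Taylor's formula with an exact remainder: the tail is \<open>y^m\<close> times another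
  convergent power series, which is bounded near 0.\<close>

lemma eval_fps_split:
  fixes A :: "real fps"
  assumes "norm y < fps_conv_radius A"
  shows "eval_fps A y = (\<Sum>i<m. fps_nth A i * y ^ i) + y ^ m * eval_fps (fps_shift m A) y"
proof -
  have s: "summable (\<lambda>i. fps_nth A i * y ^ i)"
    using assms by (rule summable_fps)
  have s': "summable (\<lambda>i. fps_nth (fps_shift m A) i * y ^ i)"
    using assms by (intro summable_fps) simp
  show ?thesis
    unfolding eval_fps_def suminf_split_initial_segment[OF s, of m]
    using suminf_mult[OF s', of "y ^ m"] by (simp add: power_add mult_ac)
qed

text \<open>This links the iterated derivatives, through which the order of a zero is defined, to
  the coefficients of the series. The radius bound is part of the claim because differentiating the
  series in the induction step relies on it.\<close>

lemma higher_deriv_eval_fps: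
  fixes A :: "real fps"
  assumes "ereal r \<le> fps_conv_radius A" "\<And>y. \<bar>y\<bar> < r \<Longrightarrow> g (x + y) = eval_fps A y" "\<bar>y\<bar> < r"
  shows "ereal r \<le> fps_conv_radius (fps_nth_deriv k A) \<and>
         (deriv ^^ k) g (x + y) = eval_fps (fps_nth_deriv k A) y"
  using assms(3)
proof (induction k arbitrary: y)
  case 0
  then show ?case using assms by simp
next
  case (Suc k)
  let ?B = "fps_nth_deriv k A"
  have rad: "ereal r \<le> fps_conv_radius ?B"
    using Suc.IH[of 0] Suc.prems by simp
  have "(eval_fps ?B has_real_derivative eval_fps (fps_deriv ?B) y) (at y)"
    using ereal_less_fps_conv_radius[OF rad Suc.prems] by (rule has_field_derivative_eval_fps)
  then have "((\<lambda>z. (deriv ^^ k) g (x + z)) has_real_derivative eval_fps (fps_deriv ?B) y) (at y)"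
    by (rule has_field_derivative_transform_within_open[where S = "{-r<..<r}"])
      (use Suc in \<open>auto simp: abs_less_iff\<close>)
  then have "((deriv ^^ k) g has_real_derivative eval_fps (fps_deriv ?B) y) (at (x + y))"
    using DERIV_shift[of "(deriv ^^ k) g" _ y x] by (simp add: add.commute)
  then show ?case
    using order_trans[OF rad fps_conv_radius_deriv]
    by (simp add: DERIV_imp_deriv fps_nth_deriv_commute del: fps_nth_deriv.simps)
qed

lemma eventually_bounded_eval_fps:
  fixes A :: "real fps"
  assumes "0 < fps_conv_radius A"
  shows "\<forall>\<^sub>F y in nhds 0. \<bar>eval_fps A y\<bar> \<le> \<bar>fps_nth A 0\<bar> + 1"
proof -
  have "isCont (eval_fps A) 0"
    using assms by (intro DERIV_isCont[OF has_field_derivative_eval_fps]) (simp add: zero_ereal_def)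
  then have "(\<lambda>y. \<bar>eval_fps A y\<bar>) \<midarrow>0\<rightarrow> \<bar>fps_nth A 0\<bar>"
    unfolding isCont_def eval_fps_at_0 by (rule tendsto_rabs)
  then have "\<forall>\<^sub>F y in at 0. \<bar>eval_fps A y\<bar> < \<bar>fps_nth A 0\<bar> + 1"
    by (rule order_tendstoD) simp
  then show ?thesis
    by (auto simp: eventually_nhds_conv_at eval_fps_at_0 elim: eventually_mono)
qed

text \<open>The leading term decides: with \<open>s\<close> the sign and \<alpha> the absolute value
  of the coefficient of index \<open>n\<close>, the derivative of
  \<open>s * (g (c0 + y) - a)\<close> is \<open>y^(n - 1)\<close> times a factor tending to
  \<open>n * \<alpha>\<close>. Near 0, but off 0, it is positive because \<open>n - 1\<close> is
  even.\<close>

lemma real_analytic_odd_zero: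
  assumes g: "real_analytic g" and zero: "zero_of_order g a c0 n" and n: "odd n"
  obtains s \<alpha> r C where "\<bar>s\<bar> = 1" "\<alpha> > 0" "r > 0" "C \<ge> 0"
    "strict_mono_on {-r..r} (\<lambda>y. s * (g (c0 + y) - a))"
    "\<And>y. \<bar>y\<bar> \<le> r \<Longrightarrow> \<bar>s * (g (c0 + y) - a) - \<alpha> * y ^ n\<bar> \<le> C * \<bar>y\<bar> ^ (n + 1)"
proof -
  obtain r0 A where A: "r0 > 0" "ereal r0 \<le> fps_conv_radius A"
    "\<And>y. \<bar>y\<bar> < r0 \<Longrightarrow> g (c0 + y) = eval_fps A y"
    using real_analytic_fps[OF g, of c0] by blast
  have n0: "n > 0" using n by (rule odd_pos)
  have coeff: "(deriv ^^ k) g c0 = fact k * fps_nth A k" for k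
    using higher_deriv_eval_fps[OF A(2,3), of 0 k] A(1)
    by (simp add: eval_fps_at_0 fps_deriv_maclauren_0)
  have A0: "fps_nth A 0 = a"
    using coeff[of 0] zero by (simp add: zero_of_order_def)
  have Ak: "fps_nth A k = 0" if "0 < k" "k < n" for k
    using coeff[of k] zero that by (auto simp: zero_of_order_def)
  define s where "s = sgn (fps_nth A n)"
  define \<alpha> where "\<alpha> = \<bar>fps_nth A n\<bar>"
  have An: "fps_nth A n \<noteq> 0"
    using coeff[of n] zero by (simp add: zero_of_order_def)
  have s: "\<bar>s\<bar> = 1" "s * fps_nth A n = \<alpha>" and \<alpha>: "\<alpha> > 0"
    using An by (auto simp: s_def \<alpha>_def sgn_real_def)
  define D where "D = fps_deriv A"
  have D: "ereal r0 \<le> fps_conv_radius D"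
    using order_trans[OF A(2) fps_conv_radius_deriv] by (simp add: D_def)
  have pos: "0 < fps_conv_radius A" "0 < fps_conv_radius D"
    using ereal_less_fps_conv_radius[OF A(2), of 0] ereal_less_fps_conv_radius[OF D, of 0] A(1) 
    by (simp_all add: zero_ereal_def)
  define R where "R = fps_shift (n + 1) A"
  define S where "S = fps_shift n D"
  have expand: "s * (g (c0 + y) - a) = \<alpha> * y ^ n + s * (y ^ (n + 1) * eval_fps R y)"
    if "\<bar>y\<bar> < r0" for y
  proof -
    have "(\<Sum>i<n. fps_nth A i * y ^ i) = (\<Sum>i<n. if i = 0 then a else 0)"
      using Ak A0 by (intro sum.cong) auto
    also have "\<dots> = a"
      using n0 by simp
    finally have "g (c0 + y) = a + fps_nth A n * y ^ n + y ^ (n + 1) * eval_fps R y"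
      using eval_fps_split[OF ereal_less_fps_conv_radius[OF A(2) that], of "n + 1"] A(3)[OF that]
      by (simp add: R_def)
    then show ?thesis
      by (simp add: algebra_simps flip: s(2))
  qed
  have deriv: "((\<lambda>y. s * (g (c0 + y) - a)) has_real_derivative
      y ^ (n - 1) * (n * \<alpha> + s * (y * eval_fps S y))) (at y)" if "\<bar>y\<bar> < r0" for y
  proof -
    \<comment> \<open>Coefficient \<open>i\<close> of \<open>D\<close> is \<open>i + 1\<close> times
      coefficient \<open>i + 1\<close> of \<open>A\<close>, so below index \<open>n\<close> only the
      one at \<open>n - 1\<close> survives.\<close>
    have "(\<Sum>i<n. fps_nth D i * y ^ i) = (\<Sum>i<n. if i = n - 1 then n * fps_nth A n * y ^ (n - 1) else 0)"
      using Ak by (intro sum.cong) (auto simp: D_def)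
    also have "\<dots> = n * fps_nth A n * y ^ (n - 1)"
      using n0 by simp
    finally have *: "eval_fps D y = n * fps_nth A n * y ^ (n - 1) + y ^ n * eval_fps S y"
      using eval_fps_split[OF ereal_less_fps_conv_radius[OF D that], of n] by (simp add: S_def)
    have **: "s * eval_fps D y = y ^ (n - 1) * (n * \<alpha> + s * (y * eval_fps S y))"
      unfolding * s(2)[symmetric] using power_minus_mult[OF n0, of y] by (simp add: algebra_simps)
    have "((\<lambda>y. s * (eval_fps A y - a)) has_real_derivative s * eval_fps D y) (at y)"
      unfolding D_def using ereal_less_fps_conv_radius[OF A(2) that]
      by (auto intro!: derivative_eq_intros has_field_derivative_eval_fps)
    then show ?thesis
      unfolding **
      by (rule has_field_derivative_transform_within_open[where S = "{-r0<..<r0}"])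
        (use A(3) that in \<open>auto simp: abs_less_iff\<close>)
  qed
  have "\<forall>\<^sub>F y in nhds 0. \<bar>eval_fps R y\<bar> \<le> \<bar>fps_nth R 0\<bar> + 1 \<and>
      \<bar>eval_fps S y\<bar> \<le> \<bar>fps_nth S 0\<bar> + 1"
    using pos by (intro eventually_conj eventually_bounded_eval_fps) (simp_all add: R_def S_def)
  then obtain r1 where r1: "r1 > 0" "\<And>y. \<bar>y\<bar> < r1 \<Longrightarrow> \<bar>eval_fps R y\<bar> \<le> \<bar>fps_nth R 0\<bar> + 1"
    "\<And>y. \<bar>y\<bar> < r1 \<Longrightarrow> \<bar>eval_fps S y\<bar> \<le> \<bar>fps_nth S 0\<bar> + 1"
    by (auto simp: eventually_nhds_metric dist_real_def)
  define M where "M = \<bar>fps_nth S 0\<bar> + 1"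
  \<comment> \<open>The first two entries keep \<open>r\<close> strictly inside both intervals; the
    third gives \<open>r * M < \<alpha>\<close>, so that the correction term cannot outweigh
    \<open>n * \<alpha>\<close>.\<close>
  define r where "r = Min {r0 / 2, r1 / 2, \<alpha> / (2 * M)}"
  have M: "M > 0" by (simp add: M_def)
  have r: "r > 0" "r < r0" "r < r1" "r \<le> \<alpha> / (2 * M)"
    using A(1) r1(1) \<alpha> M unfolding r_def by auto
  then have rM: "r * M < \<alpha>"
    using M \<alpha> by (simp add: field_simps)
  have deriv_pos: "0 < y ^ (n - 1) * (n * \<alpha> + s * (y * eval_fps S y))" if "\<bar>y\<bar> < r" "y \<noteq> 0" for y
  proof -
    have "\<bar>s * (y * eval_fps S y)\<bar> \<le> r * M"
      using that r(1,3) r1(3)[of y] by (auto simp: abs_mult s(1) M_def intro!: mult_mono)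
    moreover have "\<alpha> \<le> n * \<alpha>"
      using n0 \<alpha> by simp
    ultimately have "0 < n * \<alpha> + s * (y * eval_fps S y)"
      using rM by linarith
    moreover have "0 < y ^ (n - 1)"
      using n that by (simp add: zero_less_power_eq)
    ultimately show ?thesis by simp
  qed
  define H where "H y = s * (g (c0 + y) - a)" for y
  have cont: "continuous_on {u..v} H" if "-r \<le> u" "v \<le> r" for u v
    unfolding H_def using that r(2)
    by (intro DERIV_continuous_on[OF has_field_derivative_at_within[OF deriv]]) auto
  \<comment> \<open>The derivative may vanish at 0, so monotonicity is first obtained on intervals
    with 0 outside their interior; an interval around 0 is then split there.\<close>
  have incr: "H u < H v" if "u < v" "-r \<le> u" "v \<le> r" "0 \<le> u \<or> v \<le> 0" for u v
  proof (rule DERIV_pos_imp_increasing_open[OF \<open>u < v\<close> _ cont])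
    fix y assume "u < y" "y < v"
    with that have "\<bar>y\<bar> < r" "y \<noteq> 0" by auto
    then show "\<exists>z. (H has_real_derivative z) (at y) \<and> 0 < z"
      using deriv[of y] deriv_pos[of y] r(2) unfolding H_def by (intro exI conjI) auto
  qed (use that in auto)
  have "strict_mono_on {-r..r} H"
  proof (rule strict_mono_onI)
    fix u v assume "u \<in> {-r..r}" "v \<in> {-r..r}" "u < v"
    then show "H u < H v"
      using incr[of u v] incr[of u 0] incr[of 0 v] r(1)
      by (cases "0 \<le> u \<or> v \<le> 0") auto
  qed
  moreover have "\<bar>H y - \<alpha> * y ^ n\<bar> \<le> (\<bar>fps_nth R 0\<bar> + 1) * \<bar>y\<bar> ^ (n + 1)" if "\<bar>y\<bar> \<le> r" for y
  proof -
    have y: "\<bar>y\<bar> < r0" "\<bar>y\<bar> < r1"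
      using that r(2,3) by auto
    have "H y - \<alpha> * y ^ n = s * (y ^ (n + 1) * eval_fps R y)"
      unfolding H_def expand[OF y(1)] by simp
    then have "\<bar>H y - \<alpha> * y ^ n\<bar> = \<bar>eval_fps R y\<bar> * \<bar>y\<bar> ^ (n + 1)"
      using s(1) by (simp only: abs_mult power_abs) simp
    then show ?thesis
      using mult_right_mono[OF r1(2)[OF y(2)], of "\<bar>y\<bar> ^ (n + 1)"] by simp
  qed
  ultimately show ?thesis
    unfolding H_def by (intro that[OF s(1) \<alpha> r(1), of "\<bar>fps_nth R 0\<bar> + 1"]) auto
qed

section \<open>Expansion of a smooth family to first order\<close>

lemma vector_derivative_bound:
  fixes \<phi> :: "real \<Rightarrow> 'b::real_normed_vector"
  assumes "convex S" "\<And>t. t \<in> S \<Longrightarrow> (\<phi> has_vector_derivative \<phi>' t) (at t)"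
    "\<And>t. t \<in> S \<Longrightarrow> norm (\<phi>' t) \<le> B" "x \<in> S" "y \<in> S"
  shows "norm (\<phi> x - \<phi> y) \<le> B * \<bar>x - y\<bar>"
proof -
  have "onorm (\<lambda>s. s *\<^sub>R \<phi>' t) \<le> B" if "t \<in> S" for t
    using assms(3)[OF that] mult_left_mono[of "norm (\<phi>' t)" B "\<bar>_\<bar>"]
    by (intro onorm_le) (simp add: mult.commute)
  then have "norm (\<phi> x - \<phi> y) \<le> B * norm (x - y)"
    using assms(1,2,4,5)
    by (intro differentiable_bound[where f' = "\<lambda>t s. s *\<^sub>R \<phi>' t"])
      (auto simp: has_vector_derivative_def intro: has_derivative_at_withinI)
  then show ?thesis by simp
qed

lemma has_vector_derivative_fst:
  fixes h :: "real \<times> real \<Rightarrow> 'b::real_normed_vector"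
  assumes "h differentiable (at (x, y))"
  shows "((\<lambda>x. h (x, y)) has_vector_derivative frechet_derivative h (at (x, y)) (1, 0)) (at x)"
proof -
  let ?D = "frechet_derivative h (at (x, y))"
  have D: "(h has_derivative ?D) (at (x, y))"
    using assms frechet_derivative_works by blast
  have "((\<lambda>x. h (x, y)) has_derivative (\<lambda>t. ?D (t, 0))) (at x)"
    by (rule has_derivative_compose[where f = "\<lambda>x. (x, y)" and g = h, OF _ D])
      (auto intro!: derivative_eq_intros)
  moreover have "(\<lambda>t. ?D (t, 0)) = (\<lambda>t. t *\<^sub>R ?D (1, 0))"
  proof
    show "?D (t, 0) = t *\<^sub>R ?D (1, 0)" for t
      using linear_cmul[OF has_derivative_linear[OF D], of t "(1, 0)"]
      by (simp only: scaleR_Pair scaleR_zero_right real_scaleR_def mult_1_right mult_zero_right)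
  qed
  ultimately show ?thesis
    unfolding has_vector_derivative_def by (simp only:)
qed

lemma has_vector_derivative_snd:
  fixes h :: "real \<times> real \<Rightarrow> 'b::real_normed_vector"
  assumes "h differentiable (at (x, y))"
  shows "((\<lambda>y. h (x, y)) has_vector_derivative frechet_derivative h (at (x, y)) (0, 1)) (at y)"
proof -
  let ?D = "frechet_derivative h (at (x, y))"
  have D: "(h has_derivative ?D) (at (x, y))"
    using assms frechet_derivative_works by blast
  have "((\<lambda>y. h (x, y)) has_derivative (\<lambda>t. ?D (0, t))) (at y)"
    by (rule has_derivative_compose[where f = "\<lambda>y. (x, y)" and g = h, OF _ D])
      (auto intro!: derivative_eq_intros)
  moreover have "(\<lambda>t. ?D (0, t)) = (\<lambda>t. t *\<^sub>R ?D (0, 1))"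
  proof
    show "?D (0, t) = t *\<^sub>R ?D (0, 1)" for t
      using linear_cmul[OF has_derivative_linear[OF D], of t "(0, 1)"]
      by (simp only: scaleR_Pair scaleR_zero_right real_scaleR_def mult_1_right mult_zero_right)
  qed
  ultimately show ?thesis
    unfolding has_vector_derivative_def by (simp only:)
qed

text \<open>The small-o condition concerns a punctured neighbourhood only. Continuity supplies the
  value at 0: the remainder tends to 0 and also to \<open>\<phi> 0\<close>. The condition is then
  exactly differentiability with derivative \<open>v\<close>.\<close>

lemma has_vector_derivative_smallo:
  fixes \<phi> :: "real \<Rightarrow> 'b::real_normed_vector"
  assumes "isCont \<phi> 0" "(\<lambda>\<epsilon>. norm (\<phi> \<epsilon> - \<epsilon> *\<^sub>R v)) \<in> o[at 0](\<lambda>\<epsilon>. \<epsilon>)"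
  shows "\<phi> 0 = 0" "(\<phi> has_vector_derivative v) (at 0)"
proof -
  have lim: "(\<lambda>\<epsilon>. norm (\<phi> \<epsilon> - \<epsilon> *\<^sub>R v) / \<bar>\<epsilon>\<bar>) \<midarrow>0\<rightarrow> 0"
    using tendsto_rabs[OF smalloD_tendsto[OF assms(2)]] by simp
  have "(\<lambda>\<epsilon>. norm (\<phi> \<epsilon> - \<epsilon> *\<^sub>R v) / \<bar>\<epsilon>\<bar> * \<bar>\<epsilon>\<bar>) \<midarrow>0\<rightarrow> 0 * \<bar>0\<bar>"
    using lim by (intro tendsto_intros)
  moreover have "\<forall>\<^sub>F \<epsilon> in at 0. norm (\<phi> \<epsilon> - \<epsilon> *\<^sub>R v) / \<bar>\<epsilon>\<bar> * \<bar>\<epsilon>\<bar> = norm (\<phi> \<epsilon> - \<epsilon> *\<^sub>R v)"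
    by (auto simp: eventually_at_filter)
  ultimately have "(\<lambda>\<epsilon>. norm (\<phi> \<epsilon> - \<epsilon> *\<^sub>R v)) \<midarrow>0\<rightarrow> 0"
    using Lim_transform_eventually by fastforce
  moreover have "(\<lambda>\<epsilon>. norm (\<phi> \<epsilon> - \<epsilon> *\<^sub>R v)) \<midarrow>0\<rightarrow> norm (\<phi> 0 - 0 *\<^sub>R v)"
    using assms(1) unfolding isCont_def by (intro tendsto_intros)
  ultimately show 0: "\<phi> 0 = 0"
    using LIM_unique by fastforce
  show "(\<phi> has_vector_derivative v) (at 0)"
    unfolding has_vector_derivative_def has_derivative_at
    using lim by (auto simp: 0 bounded_linear_scaleR_left)
qed

lemma C_k_on_imp_continuous_on:
  assumes "C_k_on k S h"
  shows "continuous_on S h"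
proof (cases k)
  case 0
  with assms show ?thesis by simp
next
  case (Suc m)
  with assms have "\<And>x. x \<in> S \<Longrightarrow> h differentiable (at x)" by simp
  then show ?thesis
    using differentiable_imp_continuous_within continuous_at_imp_continuous_on by blast
qed

text \<open>The first-order condition forces \<open>h\<close> to vanish and its
  \<epsilon>-derivative to equal \<open>v\<close> on the line \<epsilon> = 0. Hence the
  \<open>c\<close>-derivative is 0 at \<open>(0, c0)\<close> and, by continuity, below 1/2 nearby,
  which gives the Lipschitz bound. A local bound on the second \<epsilon>-derivative makes the
  quadratic error uniform in \<open>c\<close>.\<close>

lemma C2_first_order_expansion:
  fixes h :: "real \<times> real \<Rightarrow> 'b::real_normed_vector"
  assumes C2: "C_k_on 2 U h" and U: "open U" "(0, c0) \<in> U"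
    and first_order: "\<And>c. (0, c) \<in> U \<Longrightarrow> (\<lambda>\<epsilon>. norm (h (\<epsilon>, c) - \<epsilon> *\<^sub>R v)) \<in> o[at 0](\<lambda>\<epsilon>. \<epsilon>)"
  obtains \<delta> C where "\<delta> > 0" "C \<ge> 0"
    "\<And>\<epsilon> c. \<bar>\<epsilon>\<bar> \<le> \<delta> \<Longrightarrow> \<bar>c - c0\<bar> \<le> \<delta> \<Longrightarrow> norm (h (\<epsilon>, c) - \<epsilon> *\<^sub>R v) \<le> C * \<epsilon>\<^sup>2"
    "\<And>\<epsilon> c c'. \<bar>\<epsilon>\<bar> \<le> \<delta> \<Longrightarrow> \<bar>c - c0\<bar> \<le> \<delta> \<Longrightarrow> \<bar>c' - c0\<bar> \<le> \<delta> \<Longrightarrow>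
      norm (h (\<epsilon>, c) - h (\<epsilon>, c')) \<le> \<bar>c - c'\<bar> / 2"
proof -
  define D1 where "D1 p = frechet_derivative h (at p) (1, 0)" for p
  define D2 where "D2 p = frechet_derivative h (at p) (0, 1)" for p
  define D11 where "D11 p = frechet_derivative D1 (at p) (1, 0)" for p
  have D: "C_k_on (Suc 0) U D1" "C_k_on (Suc 0) U D2" and diff_h: "\<And>p. p \<in> U \<Longrightarrow> h differentiable (at p)"
    using C2 unfolding numeral_2_eq_2 D1_def D2_def by (subst (asm) C_k_on.simps(2), blast)+
  have diff_D1: "D1 differentiable (at p)" if "p \<in> U" for p
    using D(1) that by simp
  have cont: "continuous_on U D2" "continuous_on U D11"
    using D C_k_on_imp_continuous_on[OF D(2)] by (auto simp: D11_def)
  have h1: "((\<lambda>\<epsilon>. h (\<epsilon>, c)) has_vector_derivative D1 (\<epsilon>, c)) (at \<epsilon>)" if "(\<epsilon>, c) \<in> U" for \<epsilon> c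
    unfolding D1_def by (intro has_vector_derivative_fst diff_h that)
  have h2: "((\<lambda>c. h (\<epsilon>, c)) has_vector_derivative D2 (\<epsilon>, c)) (at c)" if "(\<epsilon>, c) \<in> U" for \<epsilon> c
    unfolding D2_def by (intro has_vector_derivative_snd diff_h that)
  have h11: "((\<lambda>\<epsilon>. D1 (\<epsilon>, c)) has_vector_derivative D11 (\<epsilon>, c)) (at \<epsilon>)" if "(\<epsilon>, c) \<in> U" for \<epsilon> c
    unfolding D11_def by (intro has_vector_derivative_fst diff_D1 that)
  have h_0: "h (0, c) = 0" and D1_0: "D1 (0, c) = v" if "(0, c) \<in> U" for c
  proof -
    have "isCont (\<lambda>\<epsilon>. h (\<epsilon>, c)) 0"
      using h1[OF that] by (rule has_vector_derivative_continuous)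
    note * = has_vector_derivative_smallo[OF this first_order[OF that]]
    show "h (0, c) = 0" by (fact *(1))
    show "D1 (0, c) = v"
      using vector_derivative_unique_at[OF h1[OF that] *(2)] .
  qed
  have D2_0: "D2 (0, c0) = 0"
  proof (rule vector_derivative_unique_at[OF h2[OF U(2)]])
    have "open ((\<lambda>c. (0, c)) -` U)"
      using U(1) by (intro open_vimage continuous_intros)
    then show "((\<lambda>c. h (0, c)) has_vector_derivative 0) (at c0)"
      by (rule has_vector_derivative_transform_within_open[rotated])
        (use U(2) h_0 in \<open>auto intro!: derivative_eq_intros\<close>)
  qed
  define C where "C = norm (D11 (0, c0)) + 1"
  have "\<forall>\<^sub>F p in at (0, c0). norm (D2 p) < 1 / 2"
    using cont(1) U D2_0
    by (intro order_tendstoD(2)[OF tendsto_norm[of _ "D2 (0, c0)"]])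
       (auto simp: continuous_on_eq_continuous_at isCont_def)
  moreover have "\<forall>\<^sub>F p in at (0, c0). norm (D11 p) < C"
    using cont(2) U
    by (intro order_tendstoD(2)[OF tendsto_norm[of _ "D11 (0, c0)"]])
       (auto simp: continuous_on_eq_continuous_at isCont_def C_def)
  ultimately have "\<forall>\<^sub>F p in nhds (0, c0). p \<in> U \<and> norm (D2 p) < 1 / 2 \<and> norm (D11 p) < C"
    using D2_0 eventually_nhds_in_open[OF U]
    by (intro eventually_conj) (auto simp: eventually_nhds_conv_at C_def)
  then obtain d where d: "d > 0"
    "\<And>p. dist p (0, c0) < d \<Longrightarrow> p \<in> U \<and> norm (D2 p) < 1 / 2 \<and> norm (D11 p) < C"
    unfolding eventually_nhds_metric by blast
  \<comment> \<open>Points of the closed rectangle have distance at most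
    \<open>2 * \<delta>\<close>, hence less than \<open>d\<close>, from
    \<open>(0, c0)\<close>.\<close>
  define \<delta> where "\<delta> = d / 3"
  have rect: "(\<epsilon>, c) \<in> U \<and> norm (D2 (\<epsilon>, c)) \<le> 1 / 2 \<and> norm (D11 (\<epsilon>, c)) \<le> C"
    if "\<bar>\<epsilon>\<bar> \<le> \<delta>" "\<bar>c - c0\<bar> \<le> \<delta>" for \<epsilon> c
  proof -
    have "dist (\<epsilon>, c) (0, c0) \<le> \<bar>\<epsilon>\<bar> + \<bar>c - c0\<bar>"
      using norm_Pair_le[of \<epsilon> "c - c0"] by (simp add: dist_norm)
    also have "\<dots> < d"
      using that d(1) by (simp add: \<delta>_def)
    finally show ?thesis
      using d(2) less_imp_le by blast
  qed
  have C: "C \<ge> 0" and \<delta>: "\<delta> > 0"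
    using d(1) by (simp_all add: C_def \<delta>_def)
  show ?thesis
  proof (rule that[OF \<delta> C])
    fix \<epsilon> c assume \<epsilon>c: "\<bar>\<epsilon>\<bar> \<le> \<delta>" "\<bar>c - c0\<bar> \<le> \<delta>"
    have c: "(0, c) \<in> U"
      using rect[OF _ \<epsilon>c(2), of 0] \<delta> by simp
    \<comment> \<open>The mean value inequality is used twice: the bound on \<open>D11\<close>
      controls \<open>D1\<close> against its value \<open>v\<close> at \<epsilon> = 0, and this in
      turn controls the derivative of \<open>h\<close> minus its linear part.\<close>
    have D1_bound: "norm (D1 (t, c) - v) \<le> C * \<bar>t\<bar>" if "\<bar>t\<bar> \<le> \<delta>" for t
      using vector_derivative_bound[of "{-\<delta>..\<delta>}" "\<lambda>t. D1 (t, c)" "\<lambda>t. D11 (t, c)" C t 0]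
        h11 rect[OF _ \<epsilon>c(2)] that \<delta> D1_0[OF c] by (auto simp: abs_le_iff)
    have "norm ((h (\<epsilon>, c) - \<epsilon> *\<^sub>R v) - (h (0, c) - 0 *\<^sub>R v)) \<le> C * \<bar>\<epsilon>\<bar> * \<bar>\<epsilon> - 0\<bar>"
    proof (rule vector_derivative_bound[of "{-\<bar>\<epsilon>\<bar>..\<bar>\<epsilon>\<bar>}"])
      fix t assume "t \<in> {-\<bar>\<epsilon>\<bar>..\<bar>\<epsilon>\<bar>}"
      then have t: "\<bar>t\<bar> \<le> \<bar>\<epsilon>\<bar>" "\<bar>t\<bar> \<le> \<delta>"
        using \<epsilon>c(1) by auto
      show "((\<lambda>t. h (t, c) - t *\<^sub>R v) has_vector_derivative D1 (t, c) - v) (at t)"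
        using rect[OF t(2) \<epsilon>c(2)] by (auto intro!: derivative_eq_intros h1)
      show "norm (D1 (t, c) - v) \<le> C * \<bar>\<epsilon>\<bar>"
        using order_trans[OF D1_bound[OF t(2)] mult_left_mono[OF t(1) C]] .
    qed auto
    then show "norm (h (\<epsilon>, c) - \<epsilon> *\<^sub>R v) \<le> C * \<epsilon>\<^sup>2"
      using h_0[OF c] by (simp add: power2_eq_square mult.assoc abs_mult_self_eq)
  next
    fix \<epsilon> c c' assume *: "\<bar>\<epsilon>\<bar> \<le> \<delta>" "\<bar>c - c0\<bar> \<le> \<delta>" "\<bar>c' - c0\<bar> \<le> \<delta>"
    have "norm (h (\<epsilon>, c) - h (\<epsilon>, c')) \<le> 1 / 2 * \<bar>c - c'\<bar>"
    proof (rule vector_derivative_bound[of "{c0 - \<delta>..c0 + \<delta>}"])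
      fix t assume "t \<in> {c0 - \<delta>..c0 + \<delta>}"
      then have "\<bar>t - c0\<bar> \<le> \<delta>" by auto
      from rect[OF *(1) this] show "((\<lambda>c. h (\<epsilon>, c)) has_vector_derivative D2 (\<epsilon>, t)) (at t)"
        "norm (D2 (\<epsilon>, t)) \<le> 1 / 2"
        by (auto intro: h2)
    qed (use * in auto)
    then show "norm (h (\<epsilon>, c) - h (\<epsilon>, c')) \<le> \<bar>c - c'\<bar> / 2" by simp
  qed
qed

section \<open>Averages over the torus\<close>

abbreviation torus_cell :: "(real ^ 'd) set" where
  "torus_cell \<equiv> cbox 0 (\<chi> i. 2 * pi)"

lemma torus_avg_const [simp]: "torus_avg (\<lambda>_ :: real ^ 'd. x :: real) = x"
proof -
  have "torus_cell \<noteq> ({} :: (real ^ 'd) set)"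
    by (simp add: interval_ne_empty_cart)
  then show ?thesis
    by (simp add: torus_avg_def content_cbox_cart)
qed

lemma torus_avg_cmult [simp]: "torus_avg (\<lambda>\<psi> :: real ^ 'd. x * h \<psi>) = x * torus_avg h" for x :: real
  by (simp add: torus_avg_def)

lemma torus_avg_add:
  fixes h k :: "real ^ 'd \<Rightarrow> real"
  assumes "continuous_on torus_cell h" "continuous_on torus_cell k"
  shows "torus_avg (\<lambda>\<psi>. h \<psi> + k \<psi>) = torus_avg h + torus_avg k"
  using assms by (simp add: torus_avg_def integral_add integrable_continuous distrib_left)

lemma torus_avg_diff:
  fixes h k :: "real ^ 'd \<Rightarrow> real"
  assumes "continuous_on torus_cell h" "continuous_on torus_cell k"
  shows "torus_avg (\<lambda>\<psi>. h \<psi> - k \<psi>) = torus_avg h - torus_avg k"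
  using assms by (simp add: torus_avg_def integral_diff integrable_continuous right_diff_distrib)

lemma torus_avg_mono:
  fixes h k :: "real ^ 'd \<Rightarrow> real"
  assumes "continuous_on torus_cell h" "continuous_on torus_cell k"
    "\<And>\<psi>. \<psi> \<in> torus_cell \<Longrightarrow> h \<psi> \<le> k \<psi>"
  shows "torus_avg h \<le> torus_avg k"
  unfolding torus_avg_def real_scaleR_def
  using assms by (intro mult_left_mono integral_le integrable_continuous) auto

lemma torus_avg_eq_0_imp:
  fixes h :: "real ^ 'd \<Rightarrow> real"
  assumes "continuous_on torus_cell h" "\<And>\<psi>. \<psi> \<in> torus_cell \<Longrightarrow> 0 \<le> h \<psi>" "torus_avg h = 0"
    "\<psi> \<in> torus_cell"
  shows "h \<psi> = 0"
proof (rule has_integral_0_cbox_imp_0[OF assms(1) _ _ _ assms(4)])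
  show "(h has_integral 0) torus_cell"
    using integrable_integral[OF integrable_continuous[OF assms(1)]] assms(3)
    by (simp add: torus_avg_def)
  show "box 0 (\<chi> i. 2 * pi) \<noteq> ({} :: (real ^ 'd) set)"
    by (auto simp: interval_ne_empty_cart)
  show "0 \<le> h x" if "x \<in> box 0 (\<chi> i. 2 * pi)" for x
    using assms(2) that box_subset_cbox by blast
qed

text \<open>Equal averages would make the nonnegative continuous function \<open>k - h\<close>
  vanish on the whole cell, in particular at the origin.\<close>

lemma torus_avg_strict_mono:
  fixes h k :: "real ^ 'd \<Rightarrow> real"
  assumes "continuous_on torus_cell h" "continuous_on torus_cell k"
    "\<And>\<psi>. \<psi> \<in> torus_cell \<Longrightarrow> h \<psi> < k \<psi>"
  shows "torus_avg h < torus_avg k"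
proof -
  have "torus_avg h \<le> torus_avg k"
    using assms by (intro torus_avg_mono) (auto intro: less_imp_le)
  moreover have "torus_avg h \<noteq> torus_avg k"
  proof
    assume "torus_avg h = torus_avg k"
    then have "torus_avg (\<lambda>\<psi>. k \<psi> - h \<psi>) = 0"
      using assms by (simp add: torus_avg_diff)
    moreover have "(0 :: real ^ 'd) \<in> torus_cell"
      by (simp add: mem_box_cart)
    ultimately have "k 0 - h 0 = 0"
      using assms by (intro torus_avg_eq_0_imp[of "\<lambda>\<psi>. k \<psi> - h \<psi>"])
        (auto intro!: continuous_intros less_imp_le)
    with assms(3)[OF \<open>0 \<in> torus_cell\<close>] show False by simp
  qed
  ultimately show ?thesis by simp
qed

text \<open>The variation splits into a change of \<open>c\<close> at a fixed point, bounded by the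
  sup-norm distance, and a change of \<psi> within one continuous function. Joint continuity is what
  continuity of parameter integrals asks for.\<close>

lemma continuous_on_apply_bcontfun_pair:
  assumes "continuous_on I Y"
  shows "continuous_on (I \<times> S) (\<lambda>(c, \<psi>). apply_bcontfun (Y c) \<psi>)"
  unfolding continuous_on_def
proof (intro ballI tendstoI)
  fix p and e :: real
  assume p: "p \<in> I \<times> S" and e: "e > 0"
  define c \<psi> where "c = fst p" and "\<psi> = snd p"
  have "continuous_on (I \<times> S) (\<lambda>q. apply_bcontfun (Y c) (snd q))"
    by (rule continuous_on_compose2[OF continuous_on_apply_bcontfun[of UNIV]]) (auto intro!: continuous_intros)
  then have 1: "\<forall>\<^sub>F q in at p within I \<times> S. dist (apply_bcontfun (Y c) (snd q)) (apply_bcontfun (Y c) \<psi>) < e / 2"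
    unfolding continuous_on_def \<psi>_def using e p by (intro tendstoD) auto
  have "continuous_on (I \<times> S) (\<lambda>q. Y (fst q))"
    by (rule continuous_on_compose2[OF assms]) (auto intro!: continuous_intros)
  then have "\<forall>\<^sub>F q in at p within I \<times> S. dist (Y (fst q)) (Y c) < e / 2"
    unfolding continuous_on_def c_def using e p by (intro tendstoD) auto
  with 1 show "\<forall>\<^sub>F q in at p within I \<times> S.
      dist (case q of (c, \<psi>) \<Rightarrow> apply_bcontfun (Y c) \<psi>) (case p of (c, \<psi>) \<Rightarrow> apply_bcontfun (Y c) \<psi>) < e"
  proof eventually_elim
    case (elim q)
    then show ?case
      using dist_bounded[of "Y (fst q)" "snd q" "Y c"]
        dist_triangle[of "apply_bcontfun (Y (fst q)) (snd q)" "apply_bcontfun (Y c) \<psi>" "apply_bcontfun (Y c) (snd q)"]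
      unfolding case_prod_beta c_def \<psi>_def by linarith
  qed
qed

text \<open>
  With \<open>W = \<zeta> + X1\<close>, the increment \<open>K \<epsilon>\<^sup>2\<close> raises the average of \<open>(\<epsilon> W)^n\<close> by at least
  \<open>K/2 \<bar>\<epsilon>\<bar>^(n+1) [W^(n-1)]\<^sub>0\<close>, which dominates the Taylor remainder unless \<open>W = 0\<close>; in that
  degenerate case \<open>Z\<close> is positive everywhere.
\<close>

lemma torus_avg_comp_pos:
  fixes W :: "real ^ 'd \<Rightarrow> real"
  assumes G: "continuous_on UNIV G" "strict_mono_on {-r..r} G" "G 0 = 0"
    and expand: "\<And>y. \<bar>y\<bar> \<le> r \<Longrightarrow> \<bar>G y - \<alpha> * y ^ n\<bar> \<le> C * \<bar>y\<bar> ^ (n + 1)"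
    and pos: "r > 0" "\<alpha> > 0" "C \<ge> 0" and n: "odd n"
    and W: "continuous_on torus_cell W" "torus_avg (\<lambda>\<psi>. W \<psi> ^ n) = 0"
  obtains K e where "K > 0" "e > 0" "\<And>\<epsilon> Z. 0 < \<bar>\<epsilon>\<bar> \<Longrightarrow> \<bar>\<epsilon>\<bar> < e \<Longrightarrow> continuous_on torus_cell Z \<Longrightarrow>
    (\<And>\<psi>. \<psi> \<in> torus_cell \<Longrightarrow> \<epsilon> * W \<psi> + K * \<epsilon>\<^sup>2 \<le> Z \<psi> \<and> \<bar>Z \<psi>\<bar> \<le> r) \<Longrightarrow>
    0 < torus_avg (\<lambda>\<psi>. G (Z \<psi>))"
proof -
  have G_Z: "continuous_on torus_cell (\<lambda>\<psi>. G (Z \<psi>))" if "continuous_on torus_cell Z" for Z :: "real ^ 'd \<Rightarrow> real"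
    using continuous_on_compose2[OF G(1) that] by simp
  obtain m where m: "n = Suc m" "even m"
    using n by (cases n) auto
  define A where "A = torus_avg (\<lambda>\<psi>. W \<psi> ^ m)"
  have W_m: "continuous_on torus_cell (\<lambda>\<psi>. W \<psi> ^ k)" for k
    using W(1) by (intro continuous_intros)
  have "0 \<le> A"
    using torus_avg_mono[OF continuous_on_const W_m, of 0 m] m(2)
    by (simp add: A_def zero_le_even_power)
  then consider "A = 0" | "A > 0" by linarith
  then show ?thesis
  proof cases
    case 1
    \<comment> \<open>A zero average of the nonnegative \<open>W^m\<close> forces
      \<open>W^m\<close>, and hence \<open>W\<close>, to vanish on the cell. This happens only for
      \<open>m > 0\<close>, since \<open>W^0\<close> has average 1.\<close>
    have W_0: "W \<psi> = 0" if "\<psi> \<in> torus_cell" for \<psi>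
      using torus_avg_eq_0_imp[OF W_m[of m] _ _ that] 1 m(2) by (simp add: A_def zero_le_even_power)
    show ?thesis
    proof (rule that[of 1 1])
      fix \<epsilon> and Z :: "real ^ 'd \<Rightarrow> real"
      assume \<epsilon>: "0 < \<bar>\<epsilon>\<bar>" and Z: "continuous_on torus_cell Z"
        "\<And>\<psi>. \<psi> \<in> torus_cell \<Longrightarrow> \<epsilon> * W \<psi> + 1 * \<epsilon>\<^sup>2 \<le> Z \<psi> \<and> \<bar>Z \<psi>\<bar> \<le> r"
      have "G 0 < G (Z \<psi>)" if "\<psi> \<in> torus_cell" for \<psi>
      proof (rule strict_mono_onD[OF G(2)])
        have "0 < \<epsilon>\<^sup>2"
          using \<epsilon> by simp
        then show "0 < Z \<psi>"
          using Z(2)[OF that] unfolding W_0[OF that] by linarith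
      qed (use Z(2)[OF that] pos in auto)
      then show "0 < torus_avg (\<lambda>\<psi>. G (Z \<psi>))"
        using torus_avg_strict_mono[OF continuous_on_const G_Z[OF Z(1)], of 0] G(3) by simp
    qed auto
  next
    case 2
    have "bounded (W ` torus_cell)"
      using compact_continuous_image[OF W(1) compact_cbox] by (rule compact_imp_bounded)
    then obtain M where M: "M > 0" "\<And>\<psi>. \<psi> \<in> torus_cell \<Longrightarrow> \<bar>W \<psi>\<bar> \<le> M"
      by (auto simp: bounded_pos)
    \<comment> \<open>\<open>B * \<epsilon>^(n + 1)\<close> will bound the Taylor remainder at
      \<open>\<epsilon> * W \<psi> + K * \<epsilon>\<^sup>2\<close>. Then \<open>K\<close> solves
      \<open>\<alpha> * (K / 2 * A) = B + 1\<close>, so that the averaged gain exceeds this loss by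
      one unit of \<open>\<epsilon>^(n + 1)\<close>.\<close>
    define B where "B = C * (M + 1) ^ (n + 1)"
    define K where "K = 2 * (B + 1) / (\<alpha> * A)"
    have B: "B \<ge> 0"
      using M(1) pos(3) by (simp add: B_def)
    have K: "K > 0" and K_eq: "\<alpha> * (K / 2 * A) = B + 1"
      using B pos(2) 2 by (simp_all add: K_def)
    \<comment> \<open>The first entry gives \<open>K * \<bar>\<epsilon>\<bar> \<le> 1\<close>, so
      that the comparison argument is at most \<open>\<bar>\<epsilon>\<bar> * (M + 1)\<close> in
      absolute value; the second keeps this below \<open>r\<close>, where the expansion is
      valid.\<close>
    define e where "e = min (1 / K) (r / (M + 1))"
    show ?thesis
    proof (rule that[OF K, of e])
      show "e > 0"
        using K M(1) pos(1) by (simp add: e_def)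
      fix \<epsilon> and Z :: "real ^ 'd \<Rightarrow> real"
      assume \<epsilon>: "0 < \<bar>\<epsilon>\<bar>" "\<bar>\<epsilon>\<bar> < e" and Z: "continuous_on torus_cell Z"
        "\<And>\<psi>. \<psi> \<in> torus_cell \<Longrightarrow> \<epsilon> * W \<psi> + K * \<epsilon>\<^sup>2 \<le> Z \<psi> \<and> \<bar>Z \<psi>\<bar> \<le> r"
      have e: "K * \<bar>\<epsilon>\<bar> \<le> 1" "\<bar>\<epsilon>\<bar> * (M + 1) \<le> r"
        using \<epsilon>(2) K M(1) by (auto simp: e_def field_simps)
      \<comment> \<open>A minorant of \<open>G (Z \<psi>)\<close> whose average is computable: the
        first summand averages to 0 by the choice of \<open>W\<close>, the second to
        \<open>\<epsilon>^(n + 1)\<close>.\<close>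
      let ?k = "\<lambda>\<psi>. \<alpha> * \<epsilon> ^ n * W \<psi> ^ n + \<epsilon> ^ (n + 1) * (\<alpha> * (K / 2) * W \<psi> ^ m - B)"
      \<comment> \<open>The exponent \<open>n + 1\<close> is even, so one and the same
        \<open>K\<close> serves both signs of \<epsilon>.\<close>
      have \<epsilon>_pow: "0 < \<epsilon> ^ (n + 1)" "\<bar>\<epsilon>\<bar> ^ (n + 1) = \<epsilon> ^ (n + 1)"
        using \<epsilon>(1) n by (auto simp: zero_less_power_eq power_even_abs simp del: power_Suc)
      have lower: "?k \<psi> \<le> G (Z \<psi>)" if \<psi>: "\<psi> \<in> torus_cell" for \<psi>
      proof -
        define V where "V = \<epsilon> * W \<psi> + K * \<epsilon>\<^sup>2"
        have "\<bar>V\<bar> \<le> \<bar>\<epsilon> * W \<psi>\<bar> + \<bar>K * \<epsilon>\<^sup>2\<bar>"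
          unfolding V_def by (rule abs_triangle_ineq)
        also have "\<dots> = \<bar>\<epsilon>\<bar> * (\<bar>W \<psi>\<bar> + K * \<bar>\<epsilon>\<bar>)"
          using K by (simp add: abs_mult power2_eq_square algebra_simps)
        also have "\<dots> \<le> \<bar>\<epsilon>\<bar> * (M + 1)"
          using M(2)[OF \<psi>] e(1) by (intro mult_left_mono) auto
        finally have V: "\<bar>V\<bar> \<le> \<bar>\<epsilon>\<bar> * (M + 1)" .
        have "C * \<bar>V\<bar> ^ (n + 1) \<le> C * (\<bar>\<epsilon>\<bar> * (M + 1)) ^ (n + 1)"
          using V pos(3) by (intro mult_left_mono power_mono) auto
        also have "\<dots> = B * \<epsilon> ^ (n + 1)"
          unfolding B_def power_mult_distrib \<epsilon>_pow(2) by simp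
        finally have "\<alpha> * V ^ n - B * \<epsilon> ^ (n + 1) \<le> G V"
          using expand[of V] V e(2) by linarith
        moreover have "G V \<le> G (Z \<psi>)"
          using Z(2)[OF \<psi>] V e(2) by (intro strict_mono_on_leD[OF G(2)]) (auto simp: V_def)
        moreover have "\<alpha> * ((\<epsilon> * W \<psi>) ^ n + K * \<epsilon>\<^sup>2 / 2 * (\<epsilon> * W \<psi>) ^ (n - 1)) \<le> \<alpha> * V ^ n"
          unfolding V_def using n K pos(2) by (intro mult_left_mono odd_power_diff_ge) auto
        moreover have "?k \<psi> = \<alpha> * ((\<epsilon> * W \<psi>) ^ n + K * \<epsilon>\<^sup>2 / 2 * (\<epsilon> * W \<psi>) ^ (n - 1)) - B * \<epsilon> ^ (n + 1)"
          by (simp add: m(1) power_mult_distrib power2_eq_square algebra_simps)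
        ultimately show ?thesis by linarith
      qed
      have "torus_avg ?k = torus_avg (\<lambda>\<psi>. \<alpha> * \<epsilon> ^ n * W \<psi> ^ n) +
          torus_avg (\<lambda>\<psi>. \<epsilon> ^ (n + 1) * (\<alpha> * (K / 2) * W \<psi> ^ m - B))"
        by (intro torus_avg_add continuous_intros W)
      also have "\<dots> = \<epsilon> ^ (n + 1) * torus_avg (\<lambda>\<psi>. \<alpha> * (K / 2) * W \<psi> ^ m - B)"
        unfolding torus_avg_cmult W(2) by simp
      also have "torus_avg (\<lambda>\<psi>. \<alpha> * (K / 2) * W \<psi> ^ m - B) = torus_avg (\<lambda>\<psi>. \<alpha> * (K / 2) * W \<psi> ^ m) - torus_avg (\<lambda>\<psi> :: real ^ 'd. B)"
        by (intro torus_avg_diff continuous_intros W)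
      also have "\<dots> = 1"
        unfolding torus_avg_cmult using K_eq by (simp add: A_def)
      finally have "0 < torus_avg ?k"
        using \<epsilon>_pow(1) by simp
      also have "torus_avg ?k \<le> torus_avg (\<lambda>\<psi>. G (Z \<psi>))"
        using lower by (intro torus_avg_mono G_Z Z(1) continuous_intros W)
      finally show "0 < torus_avg (\<lambda>\<psi>. G (Z \<psi>))" .
    qed
  qed
qed

text \<open>The average is continuous and strictly increasing in the shift, and it changes sign
  between \<open>-M\<close> and \<open>M\<close> for a bound \<open>M\<close> of \<open>h\<close>.
  Strict monotonicity also decides when the zero is at the origin.\<close>

lemma torus_avg_odd_power_shift:
  fixes h :: "real ^ 'd \<Rightarrow> real"
  assumes h: "continuous_on torus_cell h" and n: "odd n"
  obtains z where "torus_avg (\<lambda>\<psi>. (z + h \<psi>) ^ n) = 0" "z = 0 \<longleftrightarrow> torus_avg (\<lambda>\<psi>. h \<psi> ^ n) = 0"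
proof -
  let ?p = "\<lambda>z. torus_avg (\<lambda>\<psi>. (z + h \<psi>) ^ n)"
  have cont_pow: "continuous_on torus_cell (\<lambda>\<psi>. (z + h \<psi>) ^ n)" for z
    using h by (intro continuous_intros)
  have mono: "?p z < ?p z'" if "z < z'" for z z'
    using that n by (intro torus_avg_strict_mono cont_pow odd_power_strict_mono) auto
  have "bounded (h ` torus_cell)"
    using compact_continuous_image[OF h compact_cbox] by (rule compact_imp_bounded)
  then obtain M where M: "M > 0" "\<And>\<psi>. \<psi> \<in> torus_cell \<Longrightarrow> \<bar>h \<psi>\<bar> \<le> M"
    by (auto simp: bounded_pos)
  have sgn: "- M + h \<psi> \<le> 0" "0 \<le> M + h \<psi>" if "\<psi> \<in> torus_cell" for \<psi>
    using M(2)[OF that] by auto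
  have "?p (- M) \<le> torus_avg (\<lambda>_ :: real ^ 'd. 0)"
    using sgn(1) odd_pos[OF n] n
    by (intro torus_avg_mono cont_pow continuous_on_const) (auto simp: power_le_zero_eq)
  moreover have "torus_avg (\<lambda>_ :: real ^ 'd. 0) \<le> ?p M"
    using sgn(2) by (intro torus_avg_mono cont_pow continuous_on_const zero_le_power)
  moreover have "continuous_on {-M..M} ?p"
  proof -
    have "continuous_on (UNIV \<times> torus_cell) (\<lambda>(z, \<psi>). (z + h \<psi>) ^ n)"
      unfolding case_prod_beta
      by (intro continuous_intros continuous_on_compose2[OF h]) auto
    from integral_continuous_on_param[OF this] have "continuous_on UNIV ?p"
      unfolding torus_avg_def by (intro continuous_intros)
    then show ?thesis
      by (rule continuous_on_subset) simp
  qed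
  ultimately obtain z where z: "?p z = 0"
    using IVT'[of ?p "- M" 0 M] M(1) by auto
  show ?thesis
  proof (rule that[OF z])
    show "z = 0 \<longleftrightarrow> torus_avg (\<lambda>\<psi>. h \<psi> ^ n) = 0"
      using z mono[of z 0] mono[of 0 z] by (cases z "0 :: real" rule: linorder_cases) auto
  qed
qed

section \<open>The bifurcation equation\<close>

text \<open>The curves at distance \<open>K * \<epsilon>\<^sup>2\<close> from
  \<open>c0 + z * \<epsilon>\<close> act as barriers: the intermediate value theorem puts a zero
  between them, which yields existence and the error term together. Uniqueness is injectivity of
  \<open>F \<epsilon>\<close> on a fixed window around \<open>c0\<close>.\<close>

lemma bif_solution_expansion:
  fixes F :: "real \<Rightarrow> real \<Rightarrow> real"
  assumes \<delta>: "\<delta> > 0" and K: "K \<ge> 0"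
    and mono: "\<And>\<epsilon>. \<bar>\<epsilon>\<bar> \<le> \<delta> \<Longrightarrow> strict_mono_on {c0 - \<delta>..c0 + \<delta>} (F \<epsilon>)"
    and cont: "\<And>\<epsilon>. \<bar>\<epsilon>\<bar> \<le> \<delta> \<Longrightarrow> continuous_on {c0 - \<delta>..c0 + \<delta>} (F \<epsilon>)"
    and F_0: "F 0 c0 = 0"
    and signs: "\<forall>\<^sub>F \<epsilon> in at 0. F \<epsilon> (c0 + z * \<epsilon> - K * \<epsilon>\<^sup>2) \<le> 0 \<and> 0 \<le> F \<epsilon> (c0 + z * \<epsilon> + K * \<epsilon>\<^sup>2)"
  shows "\<exists>c. bif_solution F c0 c \<and> (\<forall>c'. bif_solution F c0 c' \<longrightarrow> (\<forall>\<^sub>F \<epsilon> in nhds 0. c' \<epsilon> = c \<epsilon>)) \<and>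
    (\<lambda>\<epsilon>. c \<epsilon> - (c0 + z * \<epsilon>)) \<in> O[at 0](\<lambda>\<epsilon>. \<epsilon> ^ 2)"
proof -
  define P where "P \<epsilon> x \<longleftrightarrow> \<bar>x - (c0 + z * \<epsilon>)\<bar> \<le> K * \<epsilon>\<^sup>2 \<and> F \<epsilon> x = 0" for \<epsilon> x
  have "((\<lambda>\<epsilon>. \<bar>z * \<epsilon>\<bar> + K * \<epsilon>\<^sup>2) \<longlongrightarrow> \<bar>z * 0\<bar> + K * 0\<^sup>2) (at 0)"
    by (intro tendsto_intros)
  then have "\<forall>\<^sub>F \<epsilon> in at 0. \<bar>z * \<epsilon>\<bar> + K * \<epsilon>\<^sup>2 < \<delta>"
    using \<delta> by (intro order_tendstoD(2)) auto
  moreover have near: "\<forall>\<^sub>F \<epsilon> in nhds (0 :: real). \<bar>\<epsilon>\<bar> < \<delta>"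
    using \<delta> by (auto simp: eventually_nhds_metric dist_real_def)
  then have "\<forall>\<^sub>F \<epsilon> in at (0 :: real). \<bar>\<epsilon>\<bar> < \<delta>"
    by (auto simp: eventually_at_filter elim: eventually_mono)
  ultimately have ex: "\<forall>\<^sub>F \<epsilon> in at 0. \<exists>x. P \<epsilon> x"
    using signs
  proof eventually_elim
    case (elim \<epsilon>)
    let ?l = "c0 + z * \<epsilon> - K * \<epsilon>\<^sup>2" and ?u = "c0 + z * \<epsilon> + K * \<epsilon>\<^sup>2"
    have "0 \<le> K * \<epsilon>\<^sup>2"
      using K by simp
    with elim(1) have "{?l..?u} \<subseteq> {c0 - \<delta>..c0 + \<delta>}" "?l \<le> ?u"
      by auto
    with elim(2,3) have "\<exists>x. ?l \<le> x \<and> x \<le> ?u \<and> F \<epsilon> x = 0"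
      by (intro IVT' continuous_on_subset[OF cont]) auto
    then show ?case
      unfolding P_def by (auto simp: abs_le_iff algebra_simps)
  qed
  \<comment> \<open>The value at 0 is set by hand, as \<open>ex\<close> speaks of a punctured
    neighbourhood only.\<close>
  define c where "c \<epsilon> = (if \<epsilon> = 0 then c0 else SOME x. P \<epsilon> x)" for \<epsilon>
  have c: "\<forall>\<^sub>F \<epsilon> in at 0. P \<epsilon> (c \<epsilon>)"
    using ex eventually_neq_at_within[of 0]
    by eventually_elim (auto simp: c_def intro: someI_ex)
  have c_diff: "\<forall>\<^sub>F \<epsilon> in at 0. norm (c \<epsilon> - (c0 + z * \<epsilon>)) \<le> K * \<epsilon>\<^sup>2"
    using c by eventually_elim (simp add: P_def)
  have "((\<lambda>\<epsilon>. K * \<epsilon>\<^sup>2) \<longlongrightarrow> K * 0\<^sup>2) (at 0)"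
    by (intro tendsto_intros)
  then have "((\<lambda>\<epsilon>. c \<epsilon> - (c0 + z * \<epsilon>)) \<longlongrightarrow> 0) (at 0)"
    by (intro Lim_null_comparison[OF c_diff]) simp
  moreover have "((\<lambda>\<epsilon>. c0 + z * \<epsilon>) \<longlongrightarrow> c0 + z * 0) (at 0)"
    by (intro tendsto_intros)
  ultimately have "((\<lambda>\<epsilon>. (c \<epsilon> - (c0 + z * \<epsilon>)) + (c0 + z * \<epsilon>)) \<longlongrightarrow> 0 + (c0 + z * 0)) (at 0)"
    by (rule tendsto_add)
  moreover have c_0: "c 0 = c0"
    by (simp add: c_def)
  ultimately have sol: "bif_solution F c0 c"
    using c F_0 unfolding bif_solution_def eventually_nhds_conv_at
    by (auto simp: P_def elim: eventually_mono)
  \<comment> \<open>Convergence to \<open>c0\<close> traps every solution in the window of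
    injectivity; at \<epsilon> = 0 the prescribed value \<open>c0\<close> lies there as
    well.\<close>
  have in_range: "\<forall>\<^sub>F \<epsilon> in nhds 0. d \<epsilon> \<in> {c0 - \<delta>..c0 + \<delta>} \<and> F \<epsilon> (d \<epsilon>) = 0"
    if "bif_solution F c0 d" for d
  proof (rule eventually_conj)
    have "\<forall>\<^sub>F \<epsilon> in at 0. dist (d \<epsilon>) c0 < \<delta>"
      using that \<delta> unfolding bif_solution_def by (intro tendstoD) auto
    then show "\<forall>\<^sub>F \<epsilon> in nhds 0. d \<epsilon> \<in> {c0 - \<delta>..c0 + \<delta>}"
      using that \<delta> unfolding eventually_nhds_conv_at bif_solution_def
      by (auto simp: dist_real_def abs_less_iff elim!: eventually_mono)
  qed (use that in \<open>simp add: bif_solution_def\<close>)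
  have "\<forall>\<^sub>F \<epsilon> in nhds 0. c' \<epsilon> = c \<epsilon>" if "bif_solution F c0 c'" for c'
    using in_range[OF sol] in_range[OF that] near
  proof eventually_elim
    case (elim \<epsilon>)
    then show ?case
      using inj_onD[OF strict_mono_on_imp_inj_on[OF mono[of \<epsilon>]], of "c' \<epsilon>" "c \<epsilon>"] by simp
  qed
  moreover have "(\<lambda>\<epsilon>. c \<epsilon> - (c0 + z * \<epsilon>)) \<in> O[at 0](\<lambda>\<epsilon>. \<epsilon> ^ 2)"
    using c_diff by (intro bigoI[of _ K]) simp
  ultimately show ?thesis
    using sol by blast
qed

theorem lemma2p4:
  fixes g :: "real \<Rightarrow> real"
    and f :: "real ^ 'd \<Rightarrow> real"
    and \<omega> :: "real ^ 'd"
    and c0 :: real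
    and n :: nat
    and U :: "(real \<times> real) set"
    and X :: "real \<Rightarrow> real \<Rightarrow> (real ^ 'd) \<Rightarrow>\<^sub>C real"
    and X1 :: "(real ^ 'd) \<Rightarrow>\<^sub>C real"
  assumes g: "real_analytic g"
    and f: "torus_periodic f" "real_analytic_vec f"
    and \<omega>: "bryuno \<omega>"
    and n: "odd n" "zero_of_order g (torus_avg f) c0 n"
    and U: "open U" "(0, c0) \<in> U"
    and X_series: "\<And>\<epsilon> c. (\<epsilon>, c) \<in> U \<Longrightarrow> zero_avg_series (X \<epsilon> c)"
    and X_range: "\<And>\<epsilon> c. (\<epsilon>, c) \<in> U \<Longrightarrow> range_equation g f \<omega> \<epsilon> c (apply_bcontfun (X \<epsilon> c))"
    and X_smooth: "C_infinity_on U (\<lambda>(\<epsilon>, c). X \<epsilon> c)"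
    and X1: "first_order_term f \<omega> (apply_bcontfun X1)"
    and X_first_order:
      "\<And>c. (0, c) \<in> U \<Longrightarrow> (\<lambda>\<epsilon>. norm (X \<epsilon> c - \<epsilon> *\<^sub>R X1)) \<in> o[at 0](\<lambda>\<epsilon>. \<epsilon>)"
  shows "\<exists>c. bif_solution (bif_fun g f X) c0 c \<and>
           (\<forall>c'. bif_solution (bif_fun g f X) c0 c' \<longrightarrow> (\<forall>\<^sub>F \<epsilon> in nhds 0. c' \<epsilon> = c \<epsilon>)) \<and>
           (torus_avg (\<lambda>\<psi>. apply_bcontfun X1 \<psi> ^ n) \<noteq> 0 \<longrightarrow>
              (\<exists>\<zeta>1. \<zeta>1 \<noteq> 0 \<and> (\<lambda>\<epsilon>. c \<epsilon> - (c0 + \<zeta>1 * \<epsilon>)) \<in> O[at 0](\<lambda>\<epsilon>. \<epsilon> ^ 2))) \<and>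
           (torus_avg (\<lambda>\<psi>. apply_bcontfun X1 \<psi> ^ n) = 0 \<longrightarrow>
              (\<lambda>\<epsilon>. c \<epsilon> - c0) \<in> O[at 0](\<lambda>\<epsilon>. \<epsilon> ^ 2))"
proof -

  \<comment> \<open>Normal form of \<open>g\<close> at \<open>c0\<close> and expansion of
    \<open>X\<close>\<close>
  obtain s \<alpha> r C where s: "\<bar>s\<bar> = 1" and \<alpha>: "\<alpha> > 0" and r: "r > 0" and C: "C \<ge> 0"
    and mono: "strict_mono_on {-r..r} (\<lambda>y. s * (g (c0 + y) - torus_avg f))"
    and expand: "\<And>y. \<bar>y\<bar> \<le> r \<Longrightarrow> \<bar>s * (g (c0 + y) - torus_avg f) - \<alpha> * y ^ n\<bar> \<le> C * \<bar>y\<bar> ^ (n + 1)"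
    using real_analytic_odd_zero[OF g n(2,1)] by metis
  define G where "G y = s * (g (c0 + y) - torus_avg f)" for y
  have g_cont: "continuous_on S g" for S
    using isCont_real_analytic[OF g] by (simp add: continuous_at_imp_continuous_on)
  then have G_cont: "continuous_on S G" for S
    unfolding G_def by (intro continuous_intros continuous_on_compose2[OF g_cont[of UNIV]]) auto
  have G_0: "G 0 = 0"
    using n(2) by (simp add: G_def zero_of_order_def)
  note G_mono = mono[folded G_def] and G_expand = expand[folded G_def]
  have "C_k_on 2 U (\<lambda>(\<epsilon>, c). X \<epsilon> c)"
    using X_smooth unfolding C_infinity_on_def ..
  note expansion = C2_first_order_expansion[OF this U, of X1, unfolded split_conv, OF X_first_order]
  obtain \<delta>1 C1 where \<delta>1: "\<delta>1 > 0" and C1: "C1 \<ge> 0"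
    and X_expand: "\<And>\<epsilon> c. \<bar>\<epsilon>\<bar> \<le> \<delta>1 \<Longrightarrow> \<bar>c - c0\<bar> \<le> \<delta>1 \<Longrightarrow> norm (X \<epsilon> c - \<epsilon> *\<^sub>R X1) \<le> C1 * \<epsilon>\<^sup>2"
    and X_lipschitz: "\<And>\<epsilon> c c'. \<bar>\<epsilon>\<bar> \<le> \<delta>1 \<Longrightarrow> \<bar>c - c0\<bar> \<le> \<delta>1 \<Longrightarrow> \<bar>c' - c0\<bar> \<le> \<delta>1 \<Longrightarrow>
      norm (X \<epsilon> c - X \<epsilon> c') \<le> \<bar>c - c'\<bar> / 2"
    by (rule expansion) (assumption, rule that)

  \<comment> \<open>The first-order coefficient and the comparison estimates\<close>
  obtain z where z: "torus_avg (\<lambda>\<psi>. (z + apply_bcontfun X1 \<psi>) ^ n) = 0"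
    and z_0: "z = 0 \<longleftrightarrow> torus_avg (\<lambda>\<psi>. apply_bcontfun X1 \<psi> ^ n) = 0"
    using torus_avg_odd_power_shift[OF continuous_on_apply_bcontfun n(1)] by metis
  \<comment> \<open>Along \<open>c = c0 + z * \<epsilon>\<close>, \<open>W\<close> is the
    coefficient of \<epsilon> in \<open>c - c0 + X\<close>. The choice of \<open>z\<close> cancels
    the term of order \<open>\<epsilon>^n\<close> in the averaged equation.\<close>
  define W where "W \<psi> = z + apply_bcontfun X1 \<psi>" for \<psi>
  have W_cont: "continuous_on torus_cell W"
    unfolding W_def by (intro continuous_intros continuous_on_apply_bcontfun)
  have W_avg: "torus_avg (\<lambda>\<psi>. W \<psi> ^ n) = 0"
    using z by (simp add: W_def)
  obtain K1 e1 where K1: "K1 > 0" "e1 > 0"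
    and upper: "\<And>\<epsilon> Z. 0 < \<bar>\<epsilon>\<bar> \<Longrightarrow> \<bar>\<epsilon>\<bar> < e1 \<Longrightarrow> continuous_on torus_cell Z \<Longrightarrow>
      (\<And>\<psi>. \<psi> \<in> torus_cell \<Longrightarrow> \<epsilon> * W \<psi> + K1 * \<epsilon>\<^sup>2 \<le> Z \<psi> \<and> \<bar>Z \<psi>\<bar> \<le> r) \<Longrightarrow>
      0 < torus_avg (\<lambda>\<psi>. G (Z \<psi>))"
    using torus_avg_comp_pos[OF G_cont G_mono G_0 G_expand r \<alpha> C n(1) W_cont W_avg] by blast
  \<comment> \<open>The lower barrier reduces to the upper one by reflection: as \<open>n\<close> is
    odd, \<open>- G (- y)\<close> has the same leading term as \<open>G y\<close>, while
    \<open>W\<close> turns into \<open>- W\<close>.\<close>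
  have G'_cont: "continuous_on UNIV (\<lambda>y. - G (- y))"
    by (intro continuous_intros continuous_on_compose2[OF G_cont[of UNIV]]) auto
  have G'_mono: "strict_mono_on {-r..r} (\<lambda>y. - G (- y))"
    using strict_mono_onD[OF G_mono] by (intro strict_mono_onI) auto
  have G'_expand: "\<bar>- G (- y) - \<alpha> * y ^ n\<bar> \<le> C * \<bar>y\<bar> ^ (n + 1)" if "\<bar>y\<bar> \<le> r" for y
    using G_expand[of "- y"] that n(1) by (simp add: abs_minus_commute add.commute)
  have W'_avg: "torus_avg (\<lambda>\<psi>. (- W \<psi>) ^ n) = 0"
    using torus_avg_cmult[of "-1" "\<lambda>\<psi>. W \<psi> ^ n"] W_avg n(1) by simp
  obtain K2 e2 where K2: "K2 > 0" "e2 > 0"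
    and lower: "\<And>\<epsilon> Z. 0 < \<bar>\<epsilon>\<bar> \<Longrightarrow> \<bar>\<epsilon>\<bar> < e2 \<Longrightarrow> continuous_on torus_cell Z \<Longrightarrow>
      (\<And>\<psi>. \<psi> \<in> torus_cell \<Longrightarrow> \<epsilon> * - W \<psi> + K2 * \<epsilon>\<^sup>2 \<le> Z \<psi> \<and> \<bar>Z \<psi>\<bar> \<le> r) \<Longrightarrow>
      0 < torus_avg (\<lambda>\<psi>. - G (- Z \<psi>))"
    using torus_avg_comp_pos[OF G'_cont G'_mono _ G'_expand r \<alpha> C n(1) continuous_on_minus[OF W_cont] W'_avg]
      G_0 by auto
  \<comment> \<open>The summand \<open>C1\<close> absorbs the error of replacing \<open>X\<close> by
    its linear part.\<close>
  define K where "K = max K1 K2 + C1"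
  \<comment> \<open>The entry 1 allows the estimate of \<open>\<epsilon>\<^sup>2\<close> by
    \<open>\<bar>\<epsilon>\<bar>\<close>. The two entries with \<open>r\<close> bound
    \<open>c - c0\<close> and \<open>X\<close> by \<open>r / 2\<close> each, so that
    \<open>Z\<close> stays where \<open>G\<close> is under control.\<close>
  define \<delta> where "\<delta> = Min {\<delta>1, r / 2, 1, r / (2 * (norm X1 + C1 + 1))}"
  have pos: "norm X1 + C1 + 1 > 0"
    using C1 by (simp add: add_nonneg_pos)
  have "\<delta> > 0"
    using \<delta>1 r pos by (simp add: \<delta>_def)
  moreover have "\<delta> \<le> \<delta>1" "\<delta> \<le> r / 2" "\<delta> \<le> 1" "\<delta> \<le> r / (2 * (norm X1 + C1 + 1))"
    unfolding \<delta>_def by (rule Min_le; simp)+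
  ultimately have \<delta>: "\<delta> > 0" "\<delta> \<le> \<delta>1" "\<delta> \<le> r / 2" "\<delta> \<le> 1" "\<delta> \<le> r / (2 * (norm X1 + C1 + 1))" .
  have \<delta>_r: "\<delta> * (norm X1 + C1 + 1) \<le> r / 2"
    using \<delta>(5) pos by (simp add: field_simps)

  \<comment> \<open>Monotonicity and continuity of the bifurcation function in
    \<open>c\<close>\<close>
  define Z where "Z \<epsilon> c \<psi> = c - c0 + apply_bcontfun (X \<epsilon> c) \<psi>" for \<epsilon> c \<psi>
  have Z_cont: "continuous_on torus_cell (Z \<epsilon> c)" for \<epsilon> c
    unfolding Z_def by (intro continuous_intros continuous_on_apply_bcontfun)
  have GZ_cont: "continuous_on torus_cell (\<lambda>\<psi>. G (Z \<epsilon> c \<psi>))" for \<epsilon> c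
    by (rule continuous_on_compose2[OF G_cont[of UNIV] Z_cont]) simp
  have Z_range: "\<bar>Z \<epsilon> c \<psi>\<bar> \<le> r" if "\<bar>\<epsilon>\<bar> \<le> \<delta>" "\<bar>c - c0\<bar> \<le> \<delta>" for \<epsilon> c \<psi>
  proof -
    have "norm (X \<epsilon> c) \<le> norm (\<epsilon> *\<^sub>R X1) + norm (X \<epsilon> c - \<epsilon> *\<^sub>R X1)"
      by (rule norm_triangle_sub)
    also have "\<dots> \<le> \<bar>\<epsilon>\<bar> * norm X1 + C1 * \<epsilon>\<^sup>2"
      using X_expand[of \<epsilon> c] that \<delta>(2) by simp
    also have "\<dots> \<le> \<bar>\<epsilon>\<bar> * norm X1 + C1 * \<bar>\<epsilon>\<bar>"
      using that(1) \<delta>(4) C1 mult_left_mono[of "\<bar>\<epsilon>\<bar>" 1 "\<bar>\<epsilon>\<bar>"]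
      by (intro add_left_mono mult_left_mono) (simp_all add: power2_eq_square)
    also have "\<dots> \<le> \<delta> * (norm X1 + C1 + 1)"
      using mult_mono[OF that(1), of "norm X1 + C1" "norm X1 + C1 + 1"] C1 \<delta>(1)
      by (simp add: algebra_simps)
    finally have "\<bar>apply_bcontfun (X \<epsilon> c) \<psi>\<bar> \<le> r / 2"
      using \<delta>_r norm_bounded[of "X \<epsilon> c" \<psi>] by simp
    then show ?thesis
      using that(2) \<delta>(3) unfolding Z_def by linarith
  qed
  \<comment> \<open>The sign \<open>s\<close> makes the function increasing in \<open>c\<close> and
    leaves its zeros unchanged.\<close>
  define F where "F \<epsilon> c = s * bif_fun g f X \<epsilon> c" for \<epsilon> c
  have F_eq: "F \<epsilon> c = torus_avg (\<lambda>\<psi>. G (Z \<epsilon> c \<psi>))" for \<epsilon> c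
  proof -
    have "continuous_on torus_cell (\<lambda>\<psi>. g (c + apply_bcontfun (X \<epsilon> c) \<psi>))"
      by (rule continuous_on_compose2[OF g_cont[of UNIV]])
        (auto intro!: continuous_intros continuous_on_apply_bcontfun)
    then show ?thesis
      by (simp add: F_def bif_fun_def G_def Z_def torus_avg_diff)
  qed
  have sol: "bif_solution F c0 c \<longleftrightarrow> bif_solution (bif_fun g f X) c0 c" for c
    using s unfolding bif_solution_def F_def by auto
  have X_close: "\<bar>apply_bcontfun (X \<epsilon> c) \<psi> - \<epsilon> * apply_bcontfun X1 \<psi>\<bar> \<le> C1 * \<epsilon>\<^sup>2"
    if "\<bar>\<epsilon>\<bar> \<le> \<delta>" "\<bar>c - c0\<bar> \<le> \<delta>" for \<epsilon> c \<psi>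
    using norm_bounded[of "X \<epsilon> c - \<epsilon> *\<^sub>R X1" \<psi>] X_expand[of \<epsilon> c] that \<delta>(2) by simp
  have F_mono: "strict_mono_on {c0 - \<delta>..c0 + \<delta>} (F \<epsilon>)" if \<epsilon>: "\<bar>\<epsilon>\<bar> \<le> \<delta>" for \<epsilon>
  proof (rule strict_mono_onI)
    fix c c' assume "c \<in> {c0 - \<delta>..c0 + \<delta>}" "c' \<in> {c0 - \<delta>..c0 + \<delta>}" and less: "c < c'"
    then have c: "\<bar>c - c0\<bar> \<le> \<delta>" "\<bar>c' - c0\<bar> \<le> \<delta>" by auto
    have "G (Z \<epsilon> c \<psi>) < G (Z \<epsilon> c' \<psi>)" for \<psi>
    proof (rule strict_mono_onD[OF G_mono])
      \<comment> \<open>The Lipschitz constant 1/2 of \<open>X\<close> in \<open>c\<close> is below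
        1, so \<open>c + X\<close> still increases, at rate at least 1/2, at every point of the
        torus.\<close>
      have "apply_bcontfun (X \<epsilon> c) \<psi> - apply_bcontfun (X \<epsilon> c') \<psi> \<le> (c' - c) / 2"
        using norm_bounded[of "X \<epsilon> c - X \<epsilon> c'" \<psi>] X_lipschitz[of \<epsilon> c c'] \<epsilon> c \<delta>(2) less by simp
      then show "Z \<epsilon> c \<psi> < Z \<epsilon> c' \<psi>"
        using less unfolding Z_def by argo
    qed (use Z_range[OF \<epsilon> c(1), of \<psi>] Z_range[OF \<epsilon> c(2), of \<psi>] in auto)
    then show "F \<epsilon> c < F \<epsilon> c'"
      unfolding F_eq by (intro torus_avg_strict_mono GZ_cont)
  qed
  have F_cont: "continuous_on {c0 - \<delta>..c0 + \<delta>} (F \<epsilon>)" if \<epsilon>: "\<bar>\<epsilon>\<bar> \<le> \<delta>" for \<epsilon>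
  proof -
    let ?I = "{c0 - \<delta>..c0 + \<delta>}"
    \<comment> \<open>The same Lipschitz bound gives continuity in \<open>c\<close> for the sup
      norm, hence joint continuity of the integrand in \<open>c\<close> and \<psi>.\<close>
    have "(1 / 2)-lipschitz_on ?I (X \<epsilon>)"
    proof (rule lipschitz_onI)
      fix c c' assume "c \<in> ?I" "c' \<in> ?I"
      then have "\<bar>c - c0\<bar> \<le> \<delta>1" "\<bar>c' - c0\<bar> \<le> \<delta>1" using \<delta>(2) by auto
      then show "dist (X \<epsilon> c) (X \<epsilon> c') \<le> 1 / 2 * dist c c'"
        using X_lipschitz[of \<epsilon> c c'] \<epsilon> \<delta>(2) by (simp add: dist_norm)
    qed simp
    then have "continuous_on ?I (X \<epsilon>)"
      by (rule lipschitz_on_continuous_on)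
    then have "continuous_on (?I \<times> torus_cell) (\<lambda>p. apply_bcontfun (X \<epsilon> (fst p)) (snd p))"
      using continuous_on_apply_bcontfun_pair[of ?I "X \<epsilon>" torus_cell] by (simp add: case_prod_beta)
    then have "continuous_on (?I \<times> torus_cell) (\<lambda>p. G (Z \<epsilon> (fst p) (snd p)))"
      unfolding Z_def
      by (intro continuous_on_compose2[OF G_cont[of UNIV]] continuous_intros) auto
    then have "continuous_on (?I \<times> torus_cell) (\<lambda>(c, \<psi>). G (Z \<epsilon> c \<psi>))"
      by (simp add: case_prod_beta)
    then show ?thesis
      unfolding F_eq torus_avg_def
      by (intro continuous_intros integral_continuous_on_param)
  qed
  have F_0: "F 0 c0 = 0"
  proof -
    have "X 0 c0 = 0"
      using X_expand[of 0 c0] \<delta>1 by simp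
    then show ?thesis
      by (simp add: F_eq Z_def G_0)
  qed

  \<comment> \<open>Opposite signs at the two barriers\<close>
  have "((\<lambda>\<epsilon>. \<bar>z * \<epsilon>\<bar> + K * \<epsilon>\<^sup>2) \<longlongrightarrow> \<bar>z * 0\<bar> + K * 0\<^sup>2) (at 0)"
    by (intro tendsto_intros)
  then have small: "\<forall>\<^sub>F \<epsilon> in at 0. \<bar>z * \<epsilon>\<bar> + K * \<epsilon>\<^sup>2 < \<delta>"
    using \<delta>(1) by (intro order_tendstoD(2)) auto
  have "\<forall>\<^sub>F \<epsilon> in at (0 :: real). 0 < \<bar>\<epsilon>\<bar> \<and> \<bar>\<epsilon>\<bar> < Min {e1, e2, \<delta>}"
    unfolding eventually_at using K1(2) K2(2) \<delta>(1)
    by (intro exI[of _ "Min {e1, e2, \<delta>}"]) (simp add: dist_real_def)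
  with small have signs: "\<forall>\<^sub>F \<epsilon> in at 0. F \<epsilon> (c0 + z * \<epsilon> - K * \<epsilon>\<^sup>2) \<le> 0 \<and> 0 \<le> F \<epsilon> (c0 + z * \<epsilon> + K * \<epsilon>\<^sup>2)"
  proof eventually_elim
    case (elim \<epsilon>)
    then have \<epsilon>: "\<bar>\<epsilon>\<bar> \<le> \<delta>" "0 < \<bar>\<epsilon>\<bar>" "\<bar>\<epsilon>\<bar> < e1" "\<bar>\<epsilon>\<bar> < e2" by auto
    define l u where "l = c0 + z * \<epsilon> - K * \<epsilon>\<^sup>2" and "u = c0 + z * \<epsilon> + K * \<epsilon>\<^sup>2"
    have "0 \<le> K * \<epsilon>\<^sup>2"
      using K1(1) C1 by (simp add: K_def)
    with elim(1) have lu: "\<bar>l - c0\<bar> \<le> \<delta>" "\<bar>u - c0\<bar> \<le> \<delta>"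
      unfolding l_def u_def by linarith+
    have K: "K1 * \<epsilon>\<^sup>2 + C1 * \<epsilon>\<^sup>2 \<le> K * \<epsilon>\<^sup>2" "K2 * \<epsilon>\<^sup>2 + C1 * \<epsilon>\<^sup>2 \<le> K * \<epsilon>\<^sup>2"
      unfolding K_def distrib_right[symmetric] by (intro mult_right_mono; simp)+
    \<comment> \<open>At \<open>c = u\<close> the argument \<open>Z\<close> is
      \<open>\<epsilon> * W + K * \<epsilon>\<^sup>2\<close> plus the error of the linear part of
      \<open>X\<close>. That error costs at most \<open>C1 * \<epsilon>\<^sup>2\<close>, which
      leaves at least \<open>K1 * \<epsilon>\<^sup>2\<close>.\<close>
    have "0 < torus_avg (\<lambda>\<psi>. G (Z \<epsilon> u \<psi>))"
    proof (rule upper[OF \<epsilon>(2,3) Z_cont])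
      show "\<epsilon> * W \<psi> + K1 * \<epsilon>\<^sup>2 \<le> Z \<epsilon> u \<psi> \<and> \<bar>Z \<epsilon> u \<psi>\<bar> \<le> r" for \<psi>
        using X_close[OF \<epsilon>(1) lu(2), of \<psi>] Z_range[OF \<epsilon>(1) lu(2), of \<psi>] K(1)
        unfolding W_def by (simp add: Z_def u_def distrib_left mult.commute[of z])
    qed
    moreover have "0 < torus_avg (\<lambda>\<psi>. - G (- (- Z \<epsilon> l \<psi>)))"
    proof (rule lower[OF \<epsilon>(2,4) continuous_on_minus[OF Z_cont]])
      fix \<psi>
      have "\<epsilon> * - W \<psi> + K2 * \<epsilon>\<^sup>2 \<le> - Z \<epsilon> l \<psi>"
        using X_close[OF \<epsilon>(1) lu(1), of \<psi>] K(2)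
        unfolding W_def by (simp add: Z_def l_def right_diff_distrib mult.commute[of z])
      then show "\<epsilon> * - W \<psi> + K2 * \<epsilon>\<^sup>2 \<le> - Z \<epsilon> l \<psi> \<and> \<bar>- Z \<epsilon> l \<psi>\<bar> \<le> r"
        using Z_range[OF \<epsilon>(1) lu(1), of \<psi>] by simp
    qed
    then have "torus_avg (\<lambda>\<psi>. G (Z \<epsilon> l \<psi>)) < 0"
      using torus_avg_cmult[of "-1" "\<lambda>\<psi>. G (Z \<epsilon> l \<psi>)"] by simp
    ultimately show ?case
      unfolding F_eq l_def u_def by simp
  qed
  have "K \<ge> 0"
    using K1(1) C1 by (simp add: K_def)
  from bif_solution_expansion[OF \<delta>(1) this F_mono F_cont F_0 signs]
  obtain c where c: "bif_solution F c0 c"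
      "\<And>c'. bif_solution F c0 c' \<Longrightarrow> \<forall>\<^sub>F \<epsilon> in nhds 0. c' \<epsilon> = c \<epsilon>"
      "(\<lambda>\<epsilon>. c \<epsilon> - (c0 + z * \<epsilon>)) \<in> O[at 0](\<lambda>\<epsilon>. \<epsilon> ^ 2)"
    by auto
  show ?thesis
  \<comment> \<open>The constant \<zeta>1 is \<open>z\<close>; by \<open>z_0\<close> the linear term
    is absent exactly when the average of the \<open>n\<close>-th power of \<open>X1\<close>
    vanishes.\<close>
  proof (intro exI[of _ c] conjI allI impI)
    show "bif_solution (bif_fun g f X) c0 c"
      using c(1) sol by simp
    show "\<forall>\<^sub>F \<epsilon> in nhds 0. c' \<epsilon> = c \<epsilon>" if "bif_solution (bif_fun g f X) c0 c'" for c'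
      using c(2) that sol by simp
    show "\<exists>\<zeta>1. \<zeta>1 \<noteq> 0 \<and> (\<lambda>\<epsilon>. c \<epsilon> - (c0 + \<zeta>1 * \<epsilon>)) \<in> O[at 0](\<lambda>\<epsilon>. \<epsilon> ^ 2)"
      if "torus_avg (\<lambda>\<psi>. apply_bcontfun X1 \<psi> ^ n) \<noteq> 0"
      using c(3) that z_0 by blast
    show "(\<lambda>\<epsilon>. c \<epsilon> - c0) \<in> O[at 0](\<lambda>\<epsilon>. \<epsilon> ^ 2)"
      if "torus_avg (\<lambda>\<psi>. apply_bcontfun X1 \<psi> ^ n) = 0"
      using c(3) that z_0 by simp
  qed
qed

end
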